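(* Let $\vartheta$ be a primitive compatible random substitution on a two-letter alphabet $\mathcal{A}$ that is locally recognisable and whose second eigenvalue $\lambda_2$ satisfies $|\lambda_2|>1$. The RS-subshift $X_\vartheta$ is topologically mixing if and only if $\gcd\{|\vartheta^n(a)| : a\in\mathcal{A}\}=1$ for all $n\ge 1$.
   Context: Words and random substitutions. $\mathcal{A}=\{a_1,\dots,a_d\}$ is a finite alphabet (here $d=2$), $\mathcal{A}^+$ the set of non-empty finite words over $\mathcal{A}$, $|w|$ the length of $w$; a subword is a contiguous factor $w_{[i,j]}=w_i\cdots w_j$. A random substitution $\vartheta$ assigns to each $a\in\mathcal{A}$ a non-empty finite set $\vartheta(a)\subset\mathcal{A}^+$. It extends to words by $\vartheta(v_1\cdots v_m)=\{w_1\cdots w_m : w_i\in\vartheta(v_i)\}$ and to sets of words by $\vartheta(B)=\bigcup_{w\in B}\vartheta(w)$, so the powers $\vartheta^k$ are defined. A word is $\vartheta$-legal if it is a subword of some element of $\vartheta^k(a)$ for some $k\ge 1$, $a\in\mathcal{A}$. $X_\vartheta\subset\mathcal{A}^{\mathbb{Z}}$ is the set of bi-infinite sequences all of whose finite subwords are $\vartheta$-legal (the RS-subshift), with the shift action $\sigma$. $\vartheta$ is compatible if, for each $a\in\mathcal{A}$, all words in $\vartheta(a)$ have the same number of occurrences of each letter. Then the substitution matrix $M_\vartheta$ has $(i,j)$ entry equal to the common number of $a_i$'s in the words of $\vartheta(a_j)$, and $|\vartheta^n(a)|$ denotes the common length of the words in $\vartheta^n(a)$. $\vartheta$ is primitive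 if some power of $M_\vartheta$ has all entries positive. On two letters, the first eigenvalue $\lambda_1$ is the Perron–Frobenius eigenvalue of $M_\vartheta$ and the second eigenvalue $\lambda_2$ is the other one. Topological mixing. A subshift $X$ with language $\mathcal{L}(X)$ (the set of finite subwords of elements of $X$) is topologically mixing if for all $u,v\in\mathcal{L}(X)$ there is $N$ such that for every $n\ge N$ there is a word $w$ of length $n$ with $uwv\in\mathcal{L}(X)$. Recognisability. An inflation word decomposition of a legal word $u$ is a pair $([u_1,\dots,u_\ell],v)$ where $u_i\in\mathcal{A}^+$, $u_1\cdots u_\ell=u$, $v=v_1\cdots v_\ell$ is $\vartheta$-legal, $u_i\in\vartheta(v_i)$ for $2\le i\le \ell-1$, $u_1$ is a suffix of an element of $\vartheta(v_1)$ and $u_\ell$ is a prefix of an element of $\vartheta(v_\ell)$ (if $\ell=1$, $u_1$ is a subword of an element of $\vartheta(v_1)$). For $1\le i\le j\le |u|$, such a decomposition induces the decomposition $([\hat u_{k(i)},u_{k(i)+1},\dots,u_{k(j)-1},\hat u_{k(j)}],v_{[k(i),k(j)]})$ of $u_{[i,j]}$, where $k(i),k(j)$ are the indices of the pieces containing positions $i$ and $j$ of $u$ (i.e. $|u_1\cdots u_{k(i)-1}|<i\le|u_1\cdots u_{k(i)}|$ and likewise for $j$), and $\hat u_{k(i)}$, $\hat u_{k(j)}$ are the suffix of $u_{k(i)}$ and prefix of $u_{k(j)}$ for which the concatenation equals $u_{[i,j]}$ (if $k(i)=k(j)$, the induced decomposition is $([u_{[i,j]}],v_{k(i)})$). A legal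 word $u$ is recognisable if there is a natural number $N$ such that for each legal word $w=u^{(l)}uu^{(r)}$ with $|u^{(l)}|=|u^{(r)}|=N$, all inflation word decompositions of $w$ induce the same decomposition of this occurrence of $u$; the least such $N$ is the radius of recognisability of $u$. $\vartheta$ is locally recognisable if there is $N$ such that every $\vartheta$-legal word is recognisable with radius at most $N$. *)

theory Defs
  imports "HOL-Analysis.Analysis" "HOL-Library.Sublist"
begin

text \<open>The alphabet is a finite type; letters, words and bi-infinite sequences over it have
  types \<open>'a\<close>, \<open>'a list\<close> and \<open>int \<Rightarrow> 'a\<close>.\<close>

definition random_substitution :: "('a \<Rightarrow> 'a list set) \<Rightarrow> bool" where
  "random_substitution \<theta> \<longleftrightarrow> (\<forall>a. finite (\<theta> a) \<and> \<theta> a \<noteq> {} \<and> [] \<notin> \<theta> a)"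

definition subst_word :: "('a \<Rightarrow> 'a list set) \<Rightarrow> 'a list \<Rightarrow> 'a list set" where
  "subst_word \<theta> v = {concat ws | ws. list_all2 (\<lambda>w a. w \<in> \<theta> a) ws v}"

definition subst_set :: "('a \<Rightarrow> 'a list set) \<Rightarrow> 'a list set \<Rightarrow> 'a list set" where
  "subst_set \<theta> B = (\<Union>w\<in>B. subst_word \<theta> w)"

definition subst_pow :: "('a \<Rightarrow> 'a list set) \<Rightarrow> nat \<Rightarrow> 'a \<Rightarrow> 'a list set" where
  "subst_pow \<theta> k a = (subst_set \<theta> ^^ k) {[a]}"

text \<open>Words are non-empty throughout, so the empty word is not legal.  (The inflation word
  decompositions below make no sense for the empty word.)\<close>

definition legal :: "('a \<Rightarrow> 'a list set) \<Rightarrow> 'a list \<Rightarrow> bool" where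
  "legal \<theta> u \<longleftrightarrow> u \<noteq> [] \<and> (\<exists>k\<ge>1. \<exists>a. \<exists>w\<in>subst_pow \<theta> k a. sublist u w)"

definition RS_subshift :: "('a \<Rightarrow> 'a list set) \<Rightarrow> (int \<Rightarrow> 'a) set" where
  "RS_subshift \<theta> = {x. \<forall>i j. i \<le> j \<longrightarrow> legal \<theta> (map x [i..j])}"

definition language :: "(int \<Rightarrow> 'a) set \<Rightarrow> 'a list set" where
  "language X = {map x [i..j] | x i j. x \<in> X \<and> i \<le> j}"

definition topologically_mixing :: "(int \<Rightarrow> 'a) set \<Rightarrow> bool" where
  "topologically_mixing X \<longleftrightarrow>
     (\<forall>u\<in>language X. \<forall>v\<in>language X. \<exists>N. \<forall>n\<ge>N. \<exists>w. length w = n \<and> u @ w @ v \<in> language X)"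


definition compatible :: "('a \<Rightarrow> 'a list set) \<Rightarrow> bool" where
  "compatible \<theta> \<longleftrightarrow>
     (\<forall>a. \<forall>w\<in>\<theta> a. \<forall>w'\<in>\<theta> a. \<forall>b. count_list w b = count_list w' b)"

text \<open>The entries are well defined for compatible \<open>\<theta>\<close> only, and likewise the lengths in
  \<open>inflation_length\<close>.\<close>

definition subst_matrix :: "('a::finite \<Rightarrow> 'a list set) \<Rightarrow> real ^ 'a ^ 'a" where
  "subst_matrix \<theta> = (\<chi> i j. real (THE m. \<forall>w\<in>\<theta> j. count_list w i = m))"

definition inflation_length :: "('a \<Rightarrow> 'a list set) \<Rightarrow> nat \<Rightarrow> 'a \<Rightarrow> nat" where
  "inflation_length \<theta> n a = (THE l. \<forall>w\<in>subst_pow \<theta> n a. length w = l)"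

text \<open>\<open>M ^ k\<close> would be the componentwise power.\<close>

definition matrix_power :: "real ^ 'n ^ 'n \<Rightarrow> nat \<Rightarrow> real ^ 'n ^ 'n" where
  "matrix_power M k = (((**) M) ^^ k) (mat 1)"

definition primitive_matrix :: "real ^ 'n ^ 'n \<Rightarrow> bool" where
  "primitive_matrix M \<longleftrightarrow> (\<exists>k\<ge>1. \<forall>i j. matrix_power M k $ i $ j > 0)"

definition primitive_subst :: "('a::finite \<Rightarrow> 'a list set) \<Rightarrow> bool" where
  "primitive_subst \<theta> \<longleftrightarrow> primitive_matrix (subst_matrix \<theta>)"

definition eigenvalue :: "real ^ 'n ^ 'n \<Rightarrow> complex \<Rightarrow> bool" where
  "eigenvalue M \<mu> \<longleftrightarrow>
     (\<exists>v. v \<noteq> 0 \<and> (\<chi> i j. complex_of_real (M $ i $ j)) *v v = \<mu> *s v)"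

text \<open>The Perron--Frobenius eigenvalue of a primitive matrix: the positive eigenvalue that
  strictly dominates all other eigenvalues in modulus.\<close>

definition perron_frobenius_eigenvalue :: "real ^ 'n ^ 'n \<Rightarrow> real \<Rightarrow> bool" where
  "perron_frobenius_eigenvalue M r \<longleftrightarrow>
     r > 0 \<and> eigenvalue M (complex_of_real r) \<and>
     (\<forall>\<mu>. eigenvalue M \<mu> \<and> \<mu> \<noteq> complex_of_real r \<longrightarrow> cmod \<mu> < r)"

text \<open>The Perron--Frobenius eigenvalue of a primitive matrix is simple, so for a matrix of
  size two the remaining eigenvalue is the one different from it.\<close>

definition second_eigenvalue :: "real ^ 'n ^ 'n \<Rightarrow> complex \<Rightarrow> bool" where
  "second_eigenvalue M \<mu> \<longleftrightarrow>
     (\<exists>r. perron_frobenius_eigenvalue M r \<and> eigenvalue M \<mu> \<and> \<mu> \<noteq> complex_of_real r)"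


text \<open>All positions and indices are counted from \<open>0\<close>; \<open>factor w i j\<close> is \<open>w\<^sub>i \<cdots> w\<^sub>j\<close>,
  both ends included.\<close>

definition factor :: "'b list \<Rightarrow> nat \<Rightarrow> nat \<Rightarrow> 'b list" where
  "factor w i j = drop i (take (Suc j) w)"

definition inflation_decomposition ::
    "('a \<Rightarrow> 'a list set) \<Rightarrow> 'a list \<Rightarrow> 'a list list \<times> 'a list \<Rightarrow> bool" where
  "inflation_decomposition \<theta> u = (\<lambda>(us, v).
     legal \<theta> u \<and> legal \<theta> v \<and> length us = length v \<and> [] \<notin> set us \<and> concat us = u \<and>
     (if length us = 1 then \<exists>w\<in>\<theta> (hd v). sublist (hd us) w
      else (\<exists>w\<in>\<theta> (hd v). suffix (hd us) w) \<and>
           (\<forall>i. 1 \<le> i \<and> i + 1 < length us \<longrightarrow> us ! i \<in> \<theta> (v ! i)) \<and>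
           (\<exists>w\<in>\<theta> (last v). prefix (last us) w)))"

text \<open>\<open>piece_start us k\<close> is the position at which the piece \<open>us ! k\<close> begins, and
  \<open>piece_index us i\<close> the index of the piece containing position \<open>i\<close>.\<close>

definition piece_start :: "'a list list \<Rightarrow> nat \<Rightarrow> nat" where
  "piece_start us k = length (concat (take k us))"

definition piece_index :: "'a list list \<Rightarrow> nat \<Rightarrow> nat" where
  "piece_index us i =
     (THE k. k < length us \<and> piece_start us k \<le> i \<and> i < piece_start us (Suc k))"

definition induced_decomposition ::
    "'a list list \<times> 'a list \<Rightarrow> nat \<Rightarrow> nat \<Rightarrow> 'a list list \<times> 'a list" where
  "induced_decomposition D i j = (case D of (us, v) \<Rightarrow>
     let k = piece_index us i; l = piece_index us j in
     if k = l then ([factor (concat us) i j], [v ! k])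
     else (drop (i - piece_start us k) (us ! k)
             # drop (Suc k) (take l us)
             @ [take (Suc j - piece_start us l) (us ! l)],
           factor v k l))"

definition recognisable_within :: "('a \<Rightarrow> 'a list set) \<Rightarrow> nat \<Rightarrow> 'a list \<Rightarrow> bool" where
  "recognisable_within \<theta> N u \<longleftrightarrow>
     (\<forall>l r. length l = N \<and> length r = N \<and> legal \<theta> (l @ u @ r) \<longrightarrow>
       (\<forall>D D'. inflation_decomposition \<theta> (l @ u @ r) D \<and>
               inflation_decomposition \<theta> (l @ u @ r) D' \<longrightarrow>
          induced_decomposition D N (N + length u - 1) =
          induced_decomposition D' N (N + length u - 1)))"

definition recognisable :: "('a \<Rightarrow> 'a list set) \<Rightarrow> 'a list \<Rightarrow> bool" where
  "recognisable \<theta> u \<longleftrightarrow> legal \<theta> u \<and> (\<exists>N. recognisable_within \<theta> N u)"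

definition recognisability_radius :: "('a \<Rightarrow> 'a list set) \<Rightarrow> 'a list \<Rightarrow> nat" where
  "recognisability_radius \<theta> u = (LEAST N. recognisable_within \<theta> N u)"

definition locally_recognisable :: "('a \<Rightarrow> 'a list set) \<Rightarrow> bool" where
  "locally_recognisable \<theta> \<longleftrightarrow>
     (\<exists>N. \<forall>u. legal \<theta> u \<longrightarrow> recognisable \<theta> u \<and> recognisability_radius \<theta> u \<le> N)"

end

theory Submission
  imports Defs "HOL-Real_Asymp.Real_Asymp"
begin

text \<open>Mixing is a statement about which gaps occur between two legal words; up to bounded end terms, gaps are
sums of inflated lengths of letters.

Necessity of the gcd condition.  Local recognisability, applied level by level, yields a legal word
\<open>W\<close> whose every occurrence contains a boundary between \<open>n\<close>-fold inflated letters at one fixed offset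
(\<open>forced_cut\<close>).  Distances between occurrences of \<open>W\<close> are then sums of lengths \<open>|\<theta>^n(a)|\<close>, hence
multiples of their gcd, whereas mixing realises two consecutive distances.

Sufficiency.  Given \<open>u\<close> and \<open>v\<close>, fix \<open>k\<close> such that they occur in \<open>k\<close>-fold images of both letters.  It
suffices to find, for every large \<open>L\<close>, a legal word with prescribed end letters whose part before the
last letter has \<open>k\<close>-fold inflated length \<open>L\<close>.  As the two inflated lengths are coprime, \<open>L\<close> is an
integer combination of them in many ways, and one of these combinations is realised if legal words of
each large length \<open>n\<close> attain a long interval of letter counts (\<open>lattice_strip\<close>,
\<open>connecting_lengths\<close>).  Sliding a window shows that all intermediate counts occur, with the end letters
under control (\<open>sliding_window\<close>).

It remains to see that the spread of letter counts tends to infinity (\<open>unbounded_discrepancy\<close>), and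
this is the role of \<open>|\<lambda>\<^sub>2| > 1\<close>.  Let \<open>\<phi>\<close> be the linear functional on words given by a left eigenvector
for \<open>\<lambda>\<^sub>2\<close>; substitution multiplies \<open>\<phi>\<close> by \<open>\<lambda>\<^sub>2\<close>.  A small spread at one large length bounds \<open>\<phi>\<close> at that
length, and desubstitution carries the bound down to all smaller scales without loss.  Cutting words
into pieces of these scales then makes \<open>\<phi>\<close> grow at most logarithmically, against \<open>\<phi>(\<theta>^q(x)) =
\<lambda>\<^sub>2^q \<phi>(x)\<close>.\<close>

section \<open>Iterated images of words\<close>

text \<open>The powers \<open>subst_pow\<close> start from a single letter; restarting them from an arbitrary word lets a power
be split at any intermediate level.\<close>

definition iterate :: "('a \<Rightarrow> 'a list set) \<Rightarrow> nat \<Rightarrow> 'a list \<Rightarrow> 'a list set" where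
  "iterate \<theta> n v = (subst_set \<theta> ^^ n) {v}"

text \<open>An additive functional on words is determined by its values on letters.  Lengths, letter counts,
inflated lengths and the linear functionals given by left eigenvectors of the substitution matrix
all have this form.\<close>

abbreviation weight :: "('a \<Rightarrow> 'b::comm_monoid_add) \<Rightarrow> 'a list \<Rightarrow> 'b" where
  "weight f w \<equiv> sum_list (map f w)"

lemma subst_word_append:
  "w \<in> subst_word \<theta> (v1 @ v2) \<longleftrightarrow>
     (\<exists>w1\<in>subst_word \<theta> v1. \<exists>w2\<in>subst_word \<theta> v2. w = w1 @ w2)"
  unfolding subst_word_def list_all2_append2
  by (auto, metis concat_append, metis concat_append list_all2_lengthD)

lemma subst_word_Nil [simp]: "subst_word \<theta> [] = {[]}"
  by (auto simp: subst_word_def)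

lemma subst_word_Cons:
  "w \<in> subst_word \<theta> (a # v) \<longleftrightarrow> (\<exists>w1\<in>\<theta> a. \<exists>w2\<in>subst_word \<theta> v. w = w1 @ w2)"
  unfolding subst_word_def list_all2_Cons2
  by (auto, blast, metis concat.simps(2))

lemma iterate_0 [simp]: "iterate \<theta> 0 v = {v}"
  by (simp add: iterate_def)

lemma iterate_Suc: "iterate \<theta> (Suc n) v = (\<Union>z\<in>iterate \<theta> n v. subst_word \<theta> z)"
  by (simp add: iterate_def subst_set_def)

lemma iterate_1: "iterate \<theta> (Suc 0) v = subst_word \<theta> v"
  by (simp add: iterate_Suc)

lemma iterate_add: "iterate \<theta> (m + n) v = (\<Union>z\<in>iterate \<theta> m v. iterate \<theta> n z)"
  by (induction n) (auto simp: iterate_Suc)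

lemma iterate_Suc': "iterate \<theta> (Suc n) v = (\<Union>z\<in>subst_word \<theta> v. iterate \<theta> n z)"
  using iterate_add[of \<theta> "Suc 0" n v] by (simp add: iterate_1)

lemma iterate_append:
  "w \<in> iterate \<theta> n (v1 @ v2) \<longleftrightarrow>
     (\<exists>w1\<in>iterate \<theta> n v1. \<exists>w2\<in>iterate \<theta> n v2. w = w1 @ w2)"
proof (induction n arbitrary: w)
  case (Suc n)
  have "w \<in> iterate \<theta> (Suc n) (v1 @ v2) \<longleftrightarrow>
      (\<exists>z1\<in>iterate \<theta> n v1. \<exists>z2\<in>iterate \<theta> n v2. w \<in> subst_word \<theta> (z1 @ z2))"
    by (simp add: iterate_Suc Suc.IH Bex_def) blast
  then show ?case
    by (simp add: subst_word_append iterate_Suc) blast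
qed auto

lemma iterate_appendI:
  "w1 \<in> iterate \<theta> n v1 \<Longrightarrow> w2 \<in> iterate \<theta> n v2 \<Longrightarrow> w1 @ w2 \<in> iterate \<theta> n (v1 @ v2)"
  by (auto simp: iterate_append)

lemma legal_iff: "legal \<theta> u \<longleftrightarrow> u \<noteq> [] \<and> (\<exists>k\<ge>1. \<exists>a. \<exists>w\<in>iterate \<theta> k [a]. sublist u w)"
  by (simp add: legal_def iterate_def subst_pow_def)

lemma legal_not_Nil: "legal \<theta> u \<Longrightarrow> u \<noteq> []"
  by (simp add: legal_def)

lemma legal_sublist: "legal \<theta> w \<Longrightarrow> sublist u w \<Longrightarrow> u \<noteq> [] \<Longrightarrow> legal \<theta> u"
  unfolding legal_def using sublist_order.order.trans by blast

lemma legal_iterate: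
  assumes "w \<in> iterate \<theta> k [a]" "k \<ge> 1" "w = p @ u @ s" "u \<noteq> []"
  shows "legal \<theta> u"
  using assms unfolding legal_iff by (blast intro: sublist_appendI)

text \<open>A functional that is constant on every \<open>\<theta> a\<close> transforms under substitution without reference to the
choice of images.  Applied to a left eigenvector this is the eigenvalue equation on words.\<close>

lemma weight_subst_word:
  assumes "\<And>a w. w \<in> \<theta> a \<Longrightarrow> weight f w = g a"
  shows "w \<in> subst_word \<theta> v \<Longrightarrow> weight f w = weight g v"
  by (induction v arbitrary: w) (auto simp: subst_word_Cons assms)

lemma weight_count:
  fixes f :: "'a::finite \<Rightarrow> 'b::comm_semiring_1"
  shows "weight f w = (\<Sum>c\<in>UNIV. f c * of_nat (count_list w c))"
proof (induction w)
  case (Cons a w)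
  have "(\<Sum>c\<in>UNIV. f c * of_nat (count_list (a # w) c)) =
     (\<Sum>c\<in>UNIV. f c * of_nat (count_list w c) + (if c = a then f c else 0))"
    by (intro sum.cong) (auto simp: algebra_simps)
  then show ?case by (simp add: Cons sum.distrib add.commute)
qed auto

locale primitive_random_substitution =
  fixes \<theta> :: "'a::finite \<Rightarrow> 'a list set"
  assumes random: "random_substitution \<theta>"
    and compat: "compatible \<theta>"
    and primitive: "primitive_subst \<theta>"
    and two_letters: "CARD('a) \<ge> 2"
begin

lemma image_exists: "\<exists>w. w \<in> \<theta> a"
  using random by (auto simp: random_substitution_def)

lemma image_not_Nil: "[] \<notin> \<theta> a"
  using random by (auto simp: random_substitution_def)

lemma subst_word_exists: "\<exists>w. w \<in> subst_word \<theta> v"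
proof (induction v)
  case (Cons a v)
  then show ?case using image_exists[of a] by (auto simp: subst_word_Cons)
qed auto

lemma iterate_exists: "\<exists>w. w \<in> iterate \<theta> n v"
  by (induction n) (use subst_word_exists in \<open>auto simp: iterate_Suc, blast\<close>)

lemma subst_word_length_ge: "w \<in> subst_word \<theta> v \<Longrightarrow> length v \<le> length w"
proof (induction v arbitrary: w)
  case (Cons a v)
  then obtain w1 w2 where "w1 \<in> \<theta> a" "w2 \<in> subst_word \<theta> v" "w = w1 @ w2"
    by (auto simp: subst_word_Cons)
  then show ?case using Cons.IH image_not_Nil[of a] by (cases w1) fastforce+
qed auto

lemma iterate_length_ge: "w \<in> iterate \<theta> n v \<Longrightarrow> length v \<le> length w"
proof (induction n arbitrary: w)
  case (Suc n)
  then obtain z where z: "z \<in> iterate \<theta> n v" "w \<in> subst_word \<theta> z"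
    by (auto simp: iterate_Suc)
  show ?case using Suc.IH[OF z(1)] subst_word_length_ge[OF z(2)] by simp
qed simp

lemma iterate_not_Nil: "w \<in> iterate \<theta> n v \<Longrightarrow> v \<noteq> [] \<Longrightarrow> w \<noteq> []"
  using iterate_length_ge[of w n v] by auto

text \<open>Compatibility says exactly that words in \<open>\<theta> a\<close> have one abelianisation, hence one value of every
additive functional.\<close>

lemma weight_image_constant:
  fixes f :: "'a \<Rightarrow> 'b::comm_semiring_1"
  shows "\<exists>g. \<forall>a. \<forall>w\<in>\<theta> a. weight f w = g a"
proof -
  have "weight f w = weight f w'" if "w \<in> \<theta> a" "w' \<in> \<theta> a" for w w' a
  proof -
    have "count_list w c = count_list w' c" for c
      using compat that unfolding compatible_def by blast
    then show ?thesis by (simp add: weight_count)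
  qed
  then have "\<forall>w\<in>\<theta> a. weight f w = weight f (SOME w. w \<in> \<theta> a)" for a
    by (metis someI)
  then show ?thesis by (intro exI[of _ "\<lambda>a. weight f (SOME w. w \<in> \<theta> a)"]) blast
qed

text \<open>Peeling off the first substitution instead of the last one makes the induction a repeated
application of compatibility, each time to the inflated length of the next lower level.\<close>

lemma length_iterate:
  "w \<in> iterate \<theta> n v \<Longrightarrow> length w = weight (inflation_length \<theta> n) v"
proof -
  have "\<exists>L. \<forall>v. \<forall>w\<in>iterate \<theta> n v. length w = weight L v" for n
  proof (induction n)
    case 0
    show ?case by (rule exI[of _ "\<lambda>_. 1"]) (simp add: sum_list_triv)
  next
    case (Suc n)
    then obtain L where L: "\<forall>v. \<forall>w\<in>iterate \<theta> n v. length w = weight L v" by blast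
    obtain g where "\<forall>a. \<forall>w\<in>\<theta> a. weight L w = g a"
      using weight_image_constant by blast
    then have "\<forall>v. \<forall>w\<in>iterate \<theta> (Suc n) v. length w = weight g v"
      using L weight_subst_word[of \<theta> L g] by (auto simp: iterate_Suc')
    then show ?case by blast
  qed
  then obtain L where L: "\<forall>v. \<forall>w\<in>iterate \<theta> n v. length w = weight L v" by blast
  have "inflation_length \<theta> n a = L a" for a
    unfolding inflation_length_def subst_pow_def iterate_def[symmetric]
  proof (rule the_equality)
    show *: "\<forall>w\<in>iterate \<theta> n [a]. length w = L a" using L by simp
    show "l = L a" if "\<forall>w\<in>iterate \<theta> n [a]. length w = l" for l
      using that * iterate_exists[of n "[a]"] by metis
  qed
  then have "inflation_length \<theta> n = L" by auto
  then show "w \<in> iterate \<theta> n v \<Longrightarrow> length w = weight (inflation_length \<theta> n) v"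
    using L by simp
qed

lemma inflation_length_pos: "inflation_length \<theta> n a > 0"
proof -
  obtain w where w: "w \<in> iterate \<theta> n [a]" using iterate_exists by blast
  have "1 \<le> length w" using iterate_length_ge[OF w] by simp
  also have "length w = inflation_length \<theta> n a" using length_iterate[OF w] by simp
  finally show ?thesis by simp
qed

lemma subst_matrix_nth: "w \<in> \<theta> a \<Longrightarrow> subst_matrix \<theta> $ b $ a = real (count_list w b)"
proof -
  assume w: "w \<in> \<theta> a"
  then have "(THE m. \<forall>w\<in>\<theta> a. count_list w b = m) = count_list w b"
    using compat unfolding compatible_def by (intro the_equality) metis+
  then show ?thesis by (simp add: subst_matrix_def)
qed

lemma real_count_list: "real (count_list w b) = weight (\<lambda>c. if c = b then 1 else 0) w"
  by (induction w) auto

lemma count_iterate: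
  "w \<in> iterate \<theta> k v \<Longrightarrow>
     real (count_list w b) = weight (\<lambda>a. matrix_power (subst_matrix \<theta>) k $ b $ a) v"
proof (induction k arbitrary: w b)
  case 0
  then show ?case
    by (simp add: matrix_power_def mat_def real_count_list) (metis (no_types))
next
  case (Suc k)
  let ?M = "subst_matrix \<theta>"
  obtain z where z: "z \<in> iterate \<theta> k v" "w \<in> subst_word \<theta> z"
    using Suc.prems by (auto simp: iterate_Suc)
  have "real (count_list w b) = weight (\<lambda>a. ?M $ b $ a) z"
    using weight_subst_word[of \<theta> _ "\<lambda>a. ?M $ b $ a", OF _ z(2)]
    by (simp add: real_count_list subst_matrix_nth)
  also have "\<dots> = (\<Sum>c\<in>UNIV. ?M $ b $ c * weight (\<lambda>a. matrix_power ?M k $ c $ a) v)"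
    by (simp add: weight_count[of _ z] Suc.IH[OF z(1)])
  also have "\<dots> = weight (\<lambda>a. \<Sum>c\<in>UNIV. ?M $ b $ c * matrix_power ?M k $ c $ a) v"
    by (induction v) (simp_all add: algebra_simps sum.distrib)
  also have "\<dots> = weight (\<lambda>a. matrix_power ?M (Suc k) $ b $ a) v"
    by (simp add: matrix_power_def matrix_matrix_mult_def)
  finally show ?case .
qed

text \<open>Primitivity gives positivity of one matrix power only; every larger iterate of a letter contains
that iterate of some other letter.\<close>

lemma primitive_iterate:
  "\<exists>K\<ge>1. \<forall>n\<ge>K. \<forall>a. \<forall>w\<in>iterate \<theta> n [a]. set w = UNIV"
proof -
  obtain K where K: "K \<ge> 1" "\<And>i j. matrix_power (subst_matrix \<theta>) K $ i $ j > 0"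
    using primitive by (auto simp: primitive_subst_def primitive_matrix_def)
  have *: "b \<in> set w" if "w \<in> iterate \<theta> K [a]" for w a b
  proof -
    have "count_list w b \<noteq> 0" using count_iterate[OF that, of b] K(2)[of b a] by simp
    then show ?thesis by (meson count_notin)
  qed
  have "b \<in> set w" if n: "n \<ge> K" and w: "w \<in> iterate \<theta> n [a]" for n w a b
  proof -
    obtain z where z: "z \<in> iterate \<theta> (n - K) [a]" "w \<in> iterate \<theta> K z"
      using w n iterate_add[of \<theta> "n - K" K "[a]"] by auto
    then obtain c z' where "z = [c] @ z'" using iterate_not_Nil[OF z(1)] by (cases z) auto
    then obtain w1 w2 where "w = w1 @ w2" "w1 \<in> iterate \<theta> K [c]"
      using z(2) iterate_append by blast
    then show ?thesis using * by simp
  qed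
  then show ?thesis using K(1) by (intro exI[of _ K]) auto
qed

section \<open>Legal words\<close>

text \<open>Once a letter carries \<open>u\<close> in one of its iterates, every letter does for all later exponents,
because that letter occurs in all sufficiently late iterates.  Two words can therefore be realised
at a common level.\<close>

lemma occurs_in_iterates:
  assumes "legal \<theta> u"
  shows "\<exists>k0. \<forall>k\<ge>k0. \<forall>c. \<exists>p s. p @ u @ s \<in> iterate \<theta> k [c]"
proof -
  obtain K where K: "\<And>n a w. n \<ge> K \<Longrightarrow> w \<in> iterate \<theta> n [a] \<Longrightarrow> set w = UNIV"
    using primitive_iterate by metis
  obtain k a p s where k: "p @ u @ s \<in> iterate \<theta> k [a]"
    using assms by (auto simp: legal_iff sublist_def)
  have "\<exists>p s. p @ u @ s \<in> iterate \<theta> n [c]" if n: "n \<ge> K + k" for n c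
  proof -
    obtain z where z: "z \<in> iterate \<theta> (n - k) [c]" using iterate_exists by blast
    have "a \<in> set z" using K[OF _ z] n by simp
    then obtain z1 z2 where zz: "z = z1 @ [a] @ z2" by (metis append_Cons append_Nil split_list)
    obtain w1 w2 where "w1 \<in> iterate \<theta> k z1" "w2 \<in> iterate \<theta> k z2"
      using iterate_exists by metis
    then have "w1 @ (p @ u @ s) @ w2 \<in> iterate \<theta> k z"
      unfolding zz using k by (intro iterate_appendI)
    then have "w1 @ (p @ u @ s) @ w2 \<in> iterate \<theta> n [c]"
      using z n iterate_add[of \<theta> "n - k" k "[c]"] by auto
    then show ?thesis by (metis append.assoc)
  qed
  then show ?thesis by blast
qed

lemma legal_substitute:
  assumes "legal \<theta> v" "w \<in> iterate \<theta> n v"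
  shows "legal \<theta> w"
proof -
  obtain k a p s where k: "k \<ge> 1" "p @ v @ s \<in> iterate \<theta> k [a]"
    using assms(1) by (auto simp: legal_iff sublist_def)
  obtain p' s' where "p' \<in> iterate \<theta> n p" "s' \<in> iterate \<theta> n s" using iterate_exists by metis
  then have "p' @ w @ s' \<in> iterate \<theta> n (p @ v @ s)" using assms(2) by (intro iterate_appendI)
  then have "p' @ w @ s' \<in> iterate \<theta> (k + n) [a]" using k(2) by (auto simp: iterate_add)
  then show ?thesis
    using legal_iterate[of _ \<theta> "k + n" a p' w s'] k(1) assms iterate_not_Nil legal_not_Nil by auto
qed

text \<open>Three consecutive iterated images each contain \<open>a\<close>, and the middle occurrence has neighbours on both
sides.\<close>

lemma legal_interior_letter: "\<exists>l r. l \<noteq> [] \<and> r \<noteq> [] \<and> legal \<theta> (l @ [a] @ r)"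
proof -
  obtain K where K: "K \<ge> 1" "\<And>n a w. n \<ge> K \<Longrightarrow> w \<in> iterate \<theta> n [a] \<Longrightarrow> set w = UNIV"
    using primitive_iterate by metis
  have two: "length w \<ge> 2" if "w \<in> iterate \<theta> K [c]" for w c
    using K(2)[OF _ that] two_letters card_length[of w] by simp
  obtain w1 where w1: "w1 \<in> iterate \<theta> K [a]" using iterate_exists by blast
  obtain c1 c2 t where t: "w1 = [c1] @ [c2] @ t"
    using two[OF w1] by (cases w1; cases "tl w1") auto
  obtain e1 e2 e3 where e: "e1 \<in> iterate \<theta> K [c1]" "e2 \<in> iterate \<theta> K [c2]" "e3 \<in> iterate \<theta> K t"
    using iterate_exists by metis
  obtain d1 d2 d' where d: "e1 = [d1] @ [d2] @ d'"
    using two[OF e(1)] by (cases e1; cases "tl e1") auto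
  obtain f1 f2 f3 where f: "f1 \<in> iterate \<theta> K [d1]" "f2 \<in> iterate \<theta> K [d2]"
    "f3 \<in> iterate \<theta> K (d' @ e2 @ e3)"
    using iterate_exists by metis
  have "e1 @ e2 @ e3 \<in> iterate \<theta> (K + K) [a]"
    using w1 iterate_appendI[OF e(1) iterate_appendI[OF e(2,3)]]
    unfolding iterate_add t by blast
  moreover have "f1 @ f2 @ f3 \<in> iterate \<theta> K (e1 @ e2 @ e3)"
    unfolding d append_assoc using f by (intro iterate_appendI)
  ultimately have fff: "f1 @ f2 @ f3 \<in> iterate \<theta> (K + K + K) [a]"
    by (subst iterate_add) blast
  have "a \<in> set f2" using K(2)[OF _ f(2)] by simp
  then obtain g h where g: "f2 = g @ a # h" by (meson split_list)
  have "f1 \<noteq> []" "f3 \<noteq> []"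
    using two[OF f(1)] iterate_not_Nil[OF f(3)] iterate_not_Nil[OF e(2)] by auto
  moreover have "legal \<theta> (f1 @ f2 @ f3)"
    using fff K(1) g legal_iterate[of _ \<theta> "K + K + K" a "[]" "f1 @ f2 @ f3" "[]"] by simp
  ultimately show ?thesis
    unfolding g by (intro exI[of _ "f1 @ g"] exI[of _ "h @ f3"]) simp
qed

lemma legal_extend:
  assumes "legal \<theta> u"
  shows "\<exists>a b. legal \<theta> ([a] @ u @ [b])"
proof -
  obtain k c p s where k: "p @ u @ s \<in> iterate \<theta> k [c]"
    using assms by (auto simp: legal_iff sublist_def)
  obtain l r where lr: "l \<noteq> []" "r \<noteq> []" "legal \<theta> (l @ [c] @ r)"
    using legal_interior_letter by blast
  obtain l' r' where l': "l' \<in> iterate \<theta> k l" "r' \<in> iterate \<theta> k r" using iterate_exists by metis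
  then have "l' @ (p @ u @ s) @ r' \<in> iterate \<theta> k (l @ [c] @ r)"
    using k by (intro iterate_appendI)
  then have leg: "legal \<theta> (l' @ (p @ u @ s) @ r')" using lr(3) legal_substitute by blast
  have ne: "l' @ p \<noteq> []" "s @ r' \<noteq> []" using l' lr iterate_not_Nil by auto
  obtain l1 a where a: "l' @ p = l1 @ [a]" using ne(1) by (metis rev_exhaust)
  obtain b r1 where b: "s @ r' = b # r1" using ne(2) by (metis neq_Nil_conv)
  have "l' @ (p @ u @ s) @ r' = l1 @ ([a] @ u @ [b]) @ r1"
    using a b by (metis append.assoc append_Cons append_Nil)
  then have "legal \<theta> ([a] @ u @ [b])"
    using leg by (metis legal_sublist sublist_appendI append_Cons list.distinct(1) append_Nil)
  then show ?thesis by blast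
qed

lemma legal_extend_by:
  assumes "legal \<theta> u"
  shows "\<exists>l r. length l = n \<and> length r = n \<and> legal \<theta> (l @ u @ r)"
proof (induction n)
  case (Suc n)
  then obtain l r where lr: "length l = n" "length r = n" "legal \<theta> (l @ u @ r)" by blast
  obtain a b where ab: "legal \<theta> ([a] @ (l @ u @ r) @ [b])" using legal_extend[OF lr(3)] by blast
  then show ?case using lr by (intro exI[of _ "a # l"] exI[of _ "r @ [b]"]) simp
qed (use assms in auto)

text \<open>Since legal words extend by one letter on both sides, nested extensions exhaust a bi-infinite
sequence; so the language consists of the legal words, and mixing becomes a statement about legal
words alone.\<close>

lemma language_subshift: "language (RS_subshift \<theta>) = {u. legal \<theta> u}"
proof (intro equalityI subsetI)
  fix u assume "u \<in> {u. legal \<theta> u}"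
  then have u: "legal \<theta> u" by simp
  have u0: "u \<noteq> []" using u by (rule legal_not_Nil)
  define f where "f = rec_nat u (\<lambda>_ w. SOME w'. legal \<theta> w' \<and> (\<exists>a b. w' = [a] @ w @ [b]))"
  have f0: "f 0 = u" by (simp add: f_def)
  have step: "legal \<theta> (f (Suc n)) \<and> (\<exists>a b. f (Suc n) = [a] @ f n @ [b])" if "legal \<theta> (f n)" for n
  proof -
    have "\<exists>w'. legal \<theta> w' \<and> (\<exists>a b. w' = [a] @ f n @ [b])"
      using legal_extend[OF that] by blast
    from someI_ex[OF this] show ?thesis by (simp add: f_def)
  qed
  have leg: "legal \<theta> (f n)" for n by (induction n) (use f0 u step in auto)
  have suc: "\<exists>a b. f (Suc n) = [a] @ f n @ [b]" for n using step leg by blast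
  have len: "length (f n) = length u + 2 * n" for n
  proof (induction n)
    case (Suc n)
    then show ?case using suc[of n] by auto
  qed (simp add: f0)
  \<comment> \<open>The word \<open>f n\<close> is to occupy the positions \<open>-n, ..., |u| + n - 1\<close>, which makes the choices coherent.\<close>
  have shift: "f (Suc n) ! Suc i = f n ! i" if "i < length u + 2 * n" for n i
    using suc[of n] len[of n] that by (auto simp: nth_append)
  define x where "x i = f (nat \<bar>i\<bar>) ! nat (i + \<bar>i\<bar>)" for i :: int
  have x: "x i = f n ! nat (i + int n)" if "nat \<bar>i\<bar> \<le> n" for i n
    using that
  proof (induction n rule: dec_induct)
    case base
    then show ?case by (simp add: x_def)
  next
    case (step n)
    have "nat (i + int (Suc n)) = Suc (nat (i + int n))" using step.hyps by auto
    moreover have "nat (i + int n) < length u + 2 * n"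
      using step.hyps u0 by (cases u) auto
    ultimately show ?case using shift step.IH by metis
  qed
  have "legal \<theta> (map x [i..j])" if ij: "i \<le> j" for i j
  proof -
    define n where "n = nat (max \<bar>i\<bar> \<bar>j\<bar>)"
    have n: "nat \<bar>t\<bar> \<le> n" if "t \<in> {i..j}" for t using that by (auto simp: n_def)
    have n': "int n \<ge> \<bar>i\<bar>" "int n \<ge> \<bar>j\<bar>" by (auto simp: n_def)
    have lu: "length u > 0" using u0 by simp
    have room: "nat (i + int n) + nat (j - i + 1) \<le> length u + 2 * n"
    proof -
      have "nat (i + int n) + nat (j - i + 1) = nat (j + int n + 1)"
        using n' ij by (simp add: nat_add_distrib[symmetric])
      then show ?thesis using n' lu by linarith
    qed
    have "map x [i..j] = take (nat (j - i + 1)) (drop (nat (i + int n)) (f n))" (is "_ = ?R")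
    proof (rule nth_equalityI)
      show "length (map x [i..j]) = length ?R" using room by (simp add: len)
      fix t assume "t < length (map x [i..j])"
      then have t: "int t < j - i + 1" by auto
      then have "x (i + int t) = f n ! nat (i + int t + int n)" using x n by auto
      moreover have "nat (i + int t + int n) = nat (i + int n) + t" using n' by auto
      moreover have "nat (i + int n) + t \<le> length (f n)" using n' t lu by (simp add: len)
      ultimately show "map x [i..j] ! t = ?R ! t" using t n' lu by (simp add: len)
    qed
    moreover have "sublist ?R (f n)"
      by (meson sublist_drop sublist_take sublist_order.order.trans)
    ultimately have "sublist (map x [i..j]) (f n)" by simp
    then show ?thesis using legal_sublist[OF leg] ij by simp
  qed
  then have X: "x \<in> RS_subshift \<theta>" by (simp add: RS_subshift_def)
  have mid: "f n ! (n + i) = u ! i" if "i < length u" for i n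
    using that by (induction n) (auto simp: f0 shift)
  have "u = map x [0..int (length u) - 1]"
  proof (rule nth_equalityI)
    fix t assume t: "t < length u"
    have "nat (int t + \<bar>int t\<bar>) = t + t" by simp
    then have "x (int t) = u ! t" using mid[OF t, of t] by (simp only: x_def abs_of_nat nat_int)
    then show "u ! t = map x [0..int (length u) - 1] ! t" using t by simp
  qed simp
  moreover have "0 \<le> int (length u) - 1" using u0 by (cases u) auto
  ultimately show "u \<in> language (RS_subshift \<theta>)" unfolding language_def using X by blast
qed (auto simp: language_def RS_subshift_def)

end

section \<open>Restricting inflation word decompositions to factors\<close>

text \<open>The recognisability hypothesis compares decompositions of one word \<open>l @ u @ r\<close> of prescribed size,
whereas decompositions arise for long inflated words.  The lemmas below cut a decomposition down to
a factor and show that the decomposition induced on any inner position range is unchanged.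
Removing letters one at a time keeps the case analysis small: either the
outermost piece shrinks or it disappears together with its letter.\<close>

lemma piece_start_0 [simp]: "piece_start us 0 = 0"
  by (simp add: piece_start_def)

lemma piece_start_Cons_Suc [simp]: "piece_start (u # us) (Suc k) = length u + piece_start us k"
  by (simp add: piece_start_def)

lemma piece_start_Suc: "k < length us \<Longrightarrow> piece_start us (Suc k) = piece_start us k + length (us ! k)"
  by (simp add: piece_start_def take_Suc_conv_app_nth)

lemma piece_start_mono: "k \<le> l \<Longrightarrow> piece_start us k \<le> piece_start us l"
  unfolding piece_start_def
  by (metis append_take_drop_id concat_append length_append le_add1 min.absorb1 take_take)

lemma piece_index_eqI:
  assumes "k < length us" "piece_start us k \<le> i" "i < piece_start us (Suc k)"
  shows "piece_index us i = k"
  unfolding piece_index_def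
proof (rule the_equality)
  fix k' assume k': "k' < length us \<and> piece_start us k' \<le> i \<and> i < piece_start us (Suc k')"
  show "k' = k"
  proof (rule ccontr)
    assume "k' \<noteq> k"
    then consider "Suc k' \<le> k" | "Suc k \<le> k'" by linarith
    then show False
      using piece_start_mono[of "Suc k'" k us] piece_start_mono[of "Suc k" k' us] k' assms
      by cases auto
  qed
qed (use assms in auto)

lemma piece_exists:
  "i < length (concat us) \<Longrightarrow>
     \<exists>k<length us. piece_start us k \<le> i \<and> i < piece_start us (Suc k)"
proof (induction us arbitrary: i)
  case (Cons u us)
  show ?case
  proof (cases "i < length u")
    case False
    then have "i - length u < length (concat us)" using Cons.prems by auto
    then obtain k where "k < length us" "piece_start us k \<le> i - length u"
      "i - length u < piece_start us (Suc k)" using Cons.IH by blast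
    then show ?thesis using False by (intro exI[of _ "Suc k"]) auto
  qed (auto intro!: exI[of _ 0])
qed auto

lemma piece_index:
  assumes "i < length (concat us)"
  shows "piece_index us i < length us" "piece_start us (piece_index us i) \<le> i"
    "i < piece_start us (Suc (piece_index us i))"
proof -
  obtain k where k: "k < length us" "piece_start us k \<le> i" "i < piece_start us (Suc k)"
    using piece_exists[OF assms] by blast
  with piece_index_eqI[OF k]
  show "piece_index us i < length us" "piece_start us (piece_index us i) \<le> i"
    "i < piece_start us (Suc (piece_index us i))" by auto
qed

lemma factor_Cons_Suc: "factor (a # w) (Suc i) (Suc j) = factor w i j"
  by (simp add: factor_def)

lemma induced_drop_letter:
  assumes "i \<le> j" "j < length (concat (h # us))"
  shows "induced_decomposition ((c # h) # us, v) (Suc i) (Suc j) =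
         induced_decomposition (h # us, v) i j"
proof -
  have idx: "piece_index ((c # h) # us) (Suc t) = piece_index (h # us) t"
    if t: "t < length (concat (h # us))" for t
  proof (rule piece_index_eqI)
    let ?k = "piece_index (h # us) t"
    note k = piece_index[OF t]
    show "?k < length ((c # h) # us)" using k(1) by simp
    show "piece_start ((c # h) # us) ?k \<le> Suc t" using k(2) by (cases ?k) auto
    show "Suc t < piece_start ((c # h) # us) (Suc ?k)" using k(3) by (cases ?k) auto
  qed
  have i: "i < length (concat (h # us))" using assms by linarith
  have mono: "piece_index (h # us) i \<le> piece_index (h # us) j"
  proof (rule ccontr)
    assume "\<not> ?thesis"
    then have "Suc (piece_index (h # us) j) \<le> piece_index (h # us) i" by simp
    from piece_start_mono[OF this, of "h # us"] piece_index(2)[OF i] piece_index(3)[OF assms(2)]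
    show False using assms(1) by linarith
  qed
  have d: "drop (Suc i - piece_start ((c # h) # us) k) (((c # h) # us) ! k) =
        drop (i - piece_start (h # us) k) ((h # us) ! k)" for k
    by (cases k) auto
  have t: "take (Suc (Suc j) - piece_start ((c # h) # us) l) (((c # h) # us) ! l) =
        take (Suc j - piece_start (h # us) l) ((h # us) ! l)" if "l > 0" for l
    using that by (cases l) auto
  have m: "drop (Suc k) (take l ((c # h) # us)) = drop (Suc k) (take l (h # us))" for k l
    by (cases l) auto
  have f: "factor (concat ((c # h) # us)) (Suc i) (Suc j) = factor (concat (h # us)) i j"
    by (simp add: factor_Cons_Suc)
  show ?thesis
    unfolding induced_decomposition_def Let_def idx[OF i] idx[OF assms(2)] prod.case d m f
    using mono t by (auto simp: Let_def)
qed

lemma induced_drop_piece: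
  assumes "i \<le> j" "j < length (concat us)"
  shows "induced_decomposition ([c] # us, a # v) (Suc i) (Suc j) =
         induced_decomposition (us, v) i j"
proof -
  have idx: "piece_index ([c] # us) (Suc t) = Suc (piece_index us t)"
    if t: "t < length (concat us)" for t
    using piece_index[OF t] by (intro piece_index_eqI) auto
  have i: "i < length (concat us)" using assms by linarith
  show ?thesis
    unfolding induced_decomposition_def Let_def idx[OF i] idx[OF assms(2)] prod.case
    by (auto simp: factor_Cons_Suc factor_def)
qed

lemma piece_start_append: "k \<le> length us \<Longrightarrow> piece_start (us @ us') k = piece_start us k"
  by (simp add: piece_start_def)

lemma induced_butlast_letter:
  assumes "i \<le> j" "j < length (concat (us @ [h]))"
  shows "induced_decomposition (us @ [h @ [c]], v) i j =
         induced_decomposition (us @ [h], v) i j"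
proof -
  have st: "piece_start (us @ [h @ [c]]) k = piece_start (us @ [h]) k" if "k \<le> length us" for k
    using that by (simp add: piece_start_append)
  have idx: "piece_index (us @ [h @ [c]]) t = piece_index (us @ [h]) t"
    if t: "t < length (concat (us @ [h]))" for t
  proof (rule piece_index_eqI)
    let ?k = "piece_index (us @ [h]) t"
    note k = piece_index[OF t]
    show "?k < length (us @ [h @ [c]])" using k(1) by simp
    show "piece_start (us @ [h @ [c]]) ?k \<le> t" using k(1,2) st by simp
    show "t < piece_start (us @ [h @ [c]]) (Suc ?k)"
      using k(1,3) st[of ?k] by (auto simp: piece_start_Suc nth_append)
  qed
  have i: "i < length (concat (us @ [h]))" using assms by linarith
  note ki = piece_index[OF i] note kj = piece_index[OF assms(2)]
  have mono: "piece_index (us @ [h]) i \<le> piece_index (us @ [h]) j"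
  proof (rule ccontr)
    assume "\<not> ?thesis"
    then have "Suc (piece_index (us @ [h]) j) \<le> piece_index (us @ [h]) i" by simp
    from piece_start_mono[OF this, of "us @ [h]"] ki(2) kj(3)
    show False using assms(1) by linarith
  qed
  have f: "factor (concat (us @ [h @ [c]])) i j = factor (concat (us @ [h])) i j"
    using assms(2) by (simp add: factor_def)
  define k where "k = piece_index (us @ [h]) i"
  define l where "l = piece_index (us @ [h]) j"
  have kl: "k \<le> l" "l \<le> length us" using mono kj by (auto simp: k_def l_def)
  have t: "take (Suc j - piece_start (us @ [h]) l) ((us @ [h @ [c]]) ! l) =
        take (Suc j - piece_start (us @ [h]) l) ((us @ [h]) ! l)"
    using kl kj(3) assms(2) by (auto simp: nth_append l_def[symmetric] piece_start_Suc)
  show ?thesis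
  proof (cases "k = l")
    case True
    then show ?thesis
      unfolding induced_decomposition_def Let_def idx[OF i] idx[OF assms(2)] prod.case f
      by (simp add: k_def l_def)
  next
    case False
    then have "k < length us" using kl by simp
    then show ?thesis
      unfolding induced_decomposition_def Let_def idx[OF i] idx[OF assms(2)] prod.case
        k_def[symmetric] l_def[symmetric]
      using False kl t st by (simp add: nth_append)
  qed
qed

lemma induced_butlast_piece:
  assumes "i \<le> j" "j < length (concat us)" "length us = length v"
  shows "induced_decomposition (us @ [h], v @ [a]) i j = induced_decomposition (us, v) i j"
proof -
  have idx: "piece_index (us @ [h]) t = piece_index us t" if t: "t < length (concat us)" for t
    using piece_index[OF t] by (intro piece_index_eqI) (auto simp: piece_start_append)
  have i: "i < length (concat us)" using assms by linarith
  note k = piece_index[OF i] piece_index[OF assms(2)]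
  then show ?thesis
    unfolding induced_decomposition_def Let_def idx[OF i] idx[OF assms(2)] prod.case
    using assms(2,3) by (auto simp: nth_append piece_start_append factor_def)
qed

lemma decomposition_drop_letter:
  assumes D: "inflation_decomposition \<theta> (c # u) (us, v)" and u: "u \<noteq> []"
  shows "\<exists>us' v'. inflation_decomposition \<theta> u (us', v') \<and>
     (\<forall>i j. i \<le> j \<longrightarrow> j < length u \<longrightarrow>
        induced_decomposition (us, v) (Suc i) (Suc j) = induced_decomposition (us', v') i j)"
proof -
  have lu: "legal \<theta> u" using D u legal_sublist[of \<theta> "c # u" u]
    by (auto simp: inflation_decomposition_def sublist_Cons_right)
  obtain p us1 where us: "us = p # us1" "p \<noteq> []"
    using D by (cases us) (auto simp: inflation_decomposition_def)
  obtain h where p: "p = c # h" using us D by (cases p) (auto simp: inflation_decomposition_def)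
  obtain a v1 where v: "v = a # v1" using us D by (cases v) (auto simp: inflation_decomposition_def)
  show ?thesis
  proof (cases "h = []")
    case False
    have "inflation_decomposition \<theta> u (h # us1, v)"
    proof (cases "us1 = []")
      case True
      obtain w where w: "w \<in> \<theta> (hd v)" "sublist (c # h) w"
        using D True unfolding us p inflation_decomposition_def by auto
      have "sublist h w"
        using sublist_order.order.trans[OF _ w(2), of h] by (simp add: sublist_Cons_right)
      then show ?thesis
        using D lu False True w(1) unfolding us p inflation_decomposition_def by auto
    next
      case us1: False
      have suf: "suffix h w" if "suffix (c # h) w" for w
        using that by (rule suffix_ConsD)
      have "(h # us1) ! i \<in> \<theta> (v ! i)" if "1 \<le> i" "i + 1 < length (h # us1)" for i
      proof -
        have "us ! i \<in> \<theta> (v ! i)"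
          using D that us1 unfolding us inflation_decomposition_def by simp
        then show ?thesis using that by (cases i) (simp_all add: us)
      qed
      then show ?thesis
        using D lu False us1 suf unfolding us p inflation_decomposition_def by auto
    qed
    moreover have "concat (h # us1) = u" using D us p by (simp add: inflation_decomposition_def)
    ultimately show ?thesis using induced_drop_letter unfolding us p by metis
  next
    case True
    have cu: "concat us1 = u" using D us p True by (simp add: inflation_decomposition_def)
    then have us1: "us1 \<noteq> []" using u by auto
    then have v1: "v1 \<noteq> []" using D us v by (auto simp: inflation_decomposition_def)
    have lv: "legal \<theta> v1" using D v v1 legal_sublist[of \<theta> v v1]
      by (auto simp: inflation_decomposition_def sublist_Cons_right)
    have mid: "us1 ! i \<in> \<theta> (v1 ! i)" if "Suc i < length us1" for i
    proof -
      have "us ! Suc i \<in> \<theta> (v ! Suc i)"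
        using D that us1 unfolding us inflation_decomposition_def by (auto split: if_splits)
      then show ?thesis by (simp add: us v)
    qed
    have last: "\<exists>w\<in>\<theta> (last v1). prefix (last us1) w"
      using D us1 v1 unfolding us v inflation_decomposition_def by (auto split: if_splits)
    have first: "\<exists>w\<in>\<theta> (hd v1). suffix (hd us1) w" if "length us1 \<noteq> 1"
    proof -
      have "Suc 0 < length us1" using that us1 by (cases us1) auto
      from mid[OF this] show ?thesis using us1 v1 by (auto simp: hd_conv_nth)
    qed
    have single: "\<exists>w\<in>\<theta> (hd v1). sublist (hd us1) w" if "length us1 = 1"
    proof -
      have "length v1 = 1" using that D unfolding us v inflation_decomposition_def by auto
      then show ?thesis using last that
        by (cases us1; cases v1) auto
    qed
    have "inflation_decomposition \<theta> u (us1, v1)"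
      using D lu lv cu mid first last single unfolding us v inflation_decomposition_def
      by simp
    then show ?thesis using induced_drop_piece cu unfolding us v p True by metis
  qed
qed

lemma decomposition_butlast_letter:
  assumes D: "inflation_decomposition \<theta> (u @ [c]) (us, v)" and u: "u \<noteq> []"
  shows "\<exists>us' v'. inflation_decomposition \<theta> u (us', v') \<and>
     (\<forall>i j. i \<le> j \<longrightarrow> j < length u \<longrightarrow>
        induced_decomposition (us, v) i j = induced_decomposition (us', v') i j)"
proof -
  have lu: "legal \<theta> u" using D u legal_sublist[of \<theta> "u @ [c]" u]
    by (auto simp: inflation_decomposition_def)
  have "us \<noteq> []" using D by (auto simp: inflation_decomposition_def)
  then obtain p us1 where us: "us = us1 @ [p]" by (cases us rule: rev_cases) auto
  have p0: "p \<noteq> []" using D us by (auto simp: inflation_decomposition_def)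
  then obtain h where p: "p = h @ [c]"
    using us D by (cases p rule: rev_cases) (auto simp: inflation_decomposition_def)
  have "v \<noteq> []" using us D by (auto simp: inflation_decomposition_def)
  then obtain a v1 where v: "v = v1 @ [a]" by (cases v rule: rev_cases) auto
  have len: "length us1 = length v1" using D us v by (simp add: inflation_decomposition_def)
  show ?thesis
  proof (cases "h = []")
    case False
    have pre: "prefix h w" if "prefix (h @ [c]) w" for w
      using that by (meson append_prefixD)
    have "inflation_decomposition \<theta> u (us1 @ [h], v)"
    proof (cases "us1 = []")
      case True
      then obtain w where w: "w \<in> \<theta> (hd v)" "sublist (h @ [c]) w"
        using D unfolding us p inflation_decomposition_def by auto
      have "sublist h w"
        using sublist_order.order.trans[OF _ w(2), of h] by simp
      then show ?thesis
        using D lu False True w(1) unfolding us p inflation_decomposition_def by auto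
    next
      case us1: False
      have "(us1 @ [h]) ! i \<in> \<theta> (v ! i)" if "1 \<le> i" "i + 1 < length (us1 @ [h])" for i
      proof -
        have "us ! i \<in> \<theta> (v ! i)"
          using D that us1 unfolding us p inflation_decomposition_def by simp
        then show ?thesis using that by (simp add: us nth_append)
      qed
      then show ?thesis
        using D lu False us1 pre unfolding us p v inflation_decomposition_def
        by (auto simp: hd_append)
    qed
    moreover have "concat (us1 @ [h]) = u" using D us p by (simp add: inflation_decomposition_def)
    ultimately show ?thesis using induced_butlast_letter unfolding us p by metis
  next
    case True
    have cu: "concat us1 = u" using D us p True by (simp add: inflation_decomposition_def)
    then have us1: "us1 \<noteq> []" using u by auto
    then have v1: "v1 \<noteq> []" using len by auto
    have lv: "legal \<theta> v1" using D v v1 legal_sublist[of \<theta> v v1]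
      by (auto simp: inflation_decomposition_def)
    have mid: "us1 ! i \<in> \<theta> (v1 ! i)" if "1 \<le> i" "i < length us1" for i
    proof -
      have "us ! i \<in> \<theta> (v ! i)"
        using D that us1 unfolding us inflation_decomposition_def by (auto split: if_splits)
      then show ?thesis using that len by (simp add: us v nth_append)
    qed
    have first: "\<exists>w\<in>\<theta> (hd v1). suffix (hd us1) w"
      using D us1 v1 unfolding us v inflation_decomposition_def by (auto split: if_splits)
    have last: "\<exists>w\<in>\<theta> (last v1). prefix (last us1) w" if "length us1 \<noteq> 1"
    proof -
      have "1 \<le> length us1 - 1" "length us1 - 1 < length us1" using that us1
        by (cases us1; cases "tl us1"; auto)+
      from mid[OF this] show ?thesis using us1 v1 len by (auto simp: last_conv_nth)
    qed
    have "inflation_decomposition \<theta> u (us1, v1)"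
      using D lu lv cu mid first last len unfolding us v inflation_decomposition_def
      by (auto intro: suffix_imp_sublist)
    then show ?thesis using induced_butlast_piece cu len unfolding us v p True by metis
  qed
qed

lemma decomposition_of_factor:
  assumes "inflation_decomposition \<theta> (p @ u @ s) (us, v)" and u: "u \<noteq> []"
  shows "\<exists>us' v'. inflation_decomposition \<theta> u (us', v') \<and>
     (\<forall>i j. i \<le> j \<longrightarrow> j < length u \<longrightarrow>
        induced_decomposition (us, v) (length p + i) (length p + j) =
        induced_decomposition (us', v') i j)"
proof -
  have right: "\<exists>us' v'. inflation_decomposition \<theta> u (us', v') \<and>
     (\<forall>i j. i \<le> j \<longrightarrow> j < length u \<longrightarrow>
        induced_decomposition (us, v) i j = induced_decomposition (us', v') i j)"
    if "inflation_decomposition \<theta> (u @ s) (us, v)" for us v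
    using that
  proof (induction s arbitrary: us v rule: rev_induct)
    case (snoc c s)
    obtain us1 v1 where 1: "inflation_decomposition \<theta> (u @ s) (us1, v1)"
      "\<forall>i j. i \<le> j \<longrightarrow> j < length (u @ s) \<longrightarrow>
        induced_decomposition (us, v) i j = induced_decomposition (us1, v1) i j"
      using decomposition_butlast_letter[of \<theta> "u @ s" c us v] u snoc.prems by auto
    obtain us2 v2 where 2: "inflation_decomposition \<theta> u (us2, v2)"
      "\<forall>i j. i \<le> j \<longrightarrow> j < length u \<longrightarrow>
        induced_decomposition (us1, v1) i j = induced_decomposition (us2, v2) i j"
      using snoc.IH[OF 1(1)] by blast
    then show ?case using 1(2) by (intro exI[of _ us2] exI[of _ v2]) simp
  qed auto
  have "\<exists>us' v'. inflation_decomposition \<theta> (u @ s) (us', v') \<and>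
     (\<forall>i j. i \<le> j \<longrightarrow> j < length (u @ s) \<longrightarrow>
        induced_decomposition (us, v) (length p + i) (length p + j) =
        induced_decomposition (us', v') i j)"
    using assms(1)
  proof (induction p arbitrary: us v)
    case (Cons c p)
    obtain us1 v1 where 1: "inflation_decomposition \<theta> (p @ u @ s) (us1, v1)"
      "\<forall>i j. i \<le> j \<longrightarrow> j < length (p @ u @ s) \<longrightarrow>
        induced_decomposition (us, v) (Suc i) (Suc j) = induced_decomposition (us1, v1) i j"
      using decomposition_drop_letter[of \<theta> c "p @ u @ s" us v] u Cons.prems by auto
    obtain us2 v2 where 2: "inflation_decomposition \<theta> (u @ s) (us2, v2)"
      "\<forall>i j. i \<le> j \<longrightarrow> j < length (u @ s) \<longrightarrow>
        induced_decomposition (us1, v1) (length p + i) (length p + j) =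
        induced_decomposition (us2, v2) i j"
      using Cons.IH[OF 1(1)] by blast
    then show ?case using 1(2) by (intro exI[of _ us2] exI[of _ v2]) simp
  qed auto
  then obtain us1 v1 where 1: "inflation_decomposition \<theta> (u @ s) (us1, v1)"
    "\<forall>i j. i \<le> j \<longrightarrow> j < length (u @ s) \<longrightarrow>
        induced_decomposition (us, v) (length p + i) (length p + j) =
        induced_decomposition (us1, v1) i j"
    by blast
  obtain us2 v2 where 2: "inflation_decomposition \<theta> u (us2, v2)"
    "\<forall>i j. i \<le> j \<longrightarrow> j < length u \<longrightarrow>
        induced_decomposition (us1, v1) i j = induced_decomposition (us2, v2) i j"
    using right[OF 1(1)] by blast
  show ?thesis using 1(2) 2 by (intro exI[of _ us2] exI[of _ v2]) simp
qed

lemma full_decomposition: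
  assumes "list_all2 (\<lambda>w a. w \<in> \<theta> a) ws v" "legal \<theta> v" "legal \<theta> (concat ws)" "[] \<notin> set ws"
  shows "inflation_decomposition \<theta> (concat ws) (ws, v)"
proof -
  have ne: "ws \<noteq> []" "v \<noteq> []" using assms(1,3) legal_not_Nil by fastforce+
  have "hd ws \<in> \<theta> (hd v)" "last ws \<in> \<theta> (last v)"
    using assms(1) ne by (auto simp: hd_conv_nth last_conv_nth list_all2_conv_all_nth)
  then show ?thesis
    using assms unfolding inflation_decomposition_def
    by (auto simp: list_all2_conv_all_nth)
qed

text \<open>When the range consists of whole pieces, the induced decomposition is the block itself.  At least two
pieces are required for the two boundary pieces to be distinct.\<close>

lemma induced_block:
  assumes "length A = length vA" "length B = length vB" "length B \<ge> 2" "[] \<notin> set B"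
  shows "induced_decomposition (A @ B @ C, vA @ vB @ vC) (length (concat A))
           (length (concat A) + length (concat B) - 1) = (B, vB)"
proof -
  obtain b B' b' where B: "B = b # B' @ [b']"
  proof (cases B)
    case (Cons b B1)
    then show ?thesis using that assms(3) by (cases B1 rule: rev_cases) auto
  qed (use assms(3) in simp)
  have ne: "b \<noteq> []" "b' \<noteq> []" using assms(4) B by auto
  have 1: "piece_index (A @ B @ C) (length (concat A)) = length A"
    using ne by (intro piece_index_eqI) (auto simp: piece_start_def B)
  define l where "l = Suc (length A + length B')"
  have 2: "piece_index (A @ B @ C) (length (concat A) + length (concat B) - 1) = l"
    using ne by (intro piece_index_eqI) (auto simp: piece_start_def B l_def Suc_diff_le neq_Nil_conv)
  have st: "piece_start (A @ B @ C) (length A) = length (concat A)"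
    "piece_start (A @ B @ C) l = length (concat A) + length (b @ concat B')"
    by (auto simp: piece_start_def B l_def)
  have "drop (Suc (length A)) (take l (A @ B @ C)) = B'" "(A @ B @ C) ! l = b'"
    "(A @ B @ C) ! length A = b" "length A \<noteq> l"
    by (auto simp: B l_def nth_append)
  moreover have "factor (vA @ vB @ vC) (length A) l = vB"
    using assms(1,2) by (simp add: factor_def l_def B)
  moreover have "Suc (length (concat A) + length (concat B) - 1)
      - (length (concat A) + length (b @ concat B')) = length b'"
    using ne by (simp add: B)
  ultimately show ?thesis
    unfolding induced_decomposition_def Let_def 1 2 prod.case st by (simp add: B)
qed

text \<open>Conversely, an induced decomposition with at least two letters locates these letters in the
ambient preimage.  The end of its first piece is a genuine cut of the ambient word, although its
beginning might lie inside a piece.\<close>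

lemma induced_block_unique:
  assumes ind: "induced_decomposition (ws, z) i j = (B, vB)" and vB: "length vB \<ge> 2"
    and ij: "i \<le> j" "j < length (concat ws)" and len: "length ws = length z"
  obtains k z2 where "z = take k z @ vB @ z2" "k < length ws"
    "piece_start ws (Suc k) = i + length (hd B)"
proof -
  define k where "k = piece_index ws i"
  define l where "l = piece_index ws j"
  have i: "i < length (concat ws)" using ij by simp
  note k = piece_index[OF i, folded k_def] and l = piece_index[OF ij(2), folded l_def]
  have "k \<noteq> l"
    using ind vB by (auto simp: induced_decomposition_def Let_def k_def l_def split: if_splits)
  then have B: "drop (i - piece_start ws k) (ws ! k) = hd B" and V: "factor z k l = vB"
    using ind by (auto simp: induced_decomposition_def Let_def k_def[symmetric] l_def[symmetric])
  have "k \<le> l"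
  proof (rule ccontr)
    assume "\<not> ?thesis"
    then have "Suc l \<le> k" by simp
    from piece_start_mono[OF this, of ws] k l show False using ij(1) by linarith
  qed
  then have "z = take k z @ vB @ drop (Suc l) z"
    unfolding V[symmetric] factor_def
    by (metis append.assoc append_take_drop_id le_Suc_eq min.absorb1 take_take)
  moreover have "piece_start ws (Suc k) = i + length (hd B)"
    using k B[symmetric] by (simp add: piece_start_Suc)
  ultimately show thesis using that k(1) by blast
qed

section \<open>Recognisability forces cut points\<close>

lemma weight_dvd: "(\<And>a. g dvd f a) \<Longrightarrow> g dvd (weight f w :: nat)"
  by (induction w) auto

context primitive_random_substitution
begin

lemma length_subst_word:
  "w \<in> subst_word \<theta> v \<Longrightarrow> length w = weight (inflation_length \<theta> (Suc 0)) v"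
  using length_iterate[of w "Suc 0" v] by (simp add: iterate_1)

lemma legal_letter: "legal \<theta> [a]"
  using legal_interior_letter[of a] legal_sublist[of \<theta> _ "[a]"] sublist_appendI by fastforce

lemma legal_subst_word: "legal \<theta> v \<Longrightarrow> w \<in> subst_word \<theta> v \<Longrightarrow> legal \<theta> w"
  using legal_substitute[of v w "Suc 0"] by (simp add: iterate_1)

lemma subst_word_pieces:
  assumes "w \<in> subst_word \<theta> v"
  obtains ws where "w = concat ws" "list_all2 (\<lambda>w a. w \<in> \<theta> a) ws v" "[] \<notin> set ws"
proof -
  obtain ws where ws: "w = concat ws" "list_all2 (\<lambda>w a. w \<in> \<theta> a) ws v"
    using assms by (auto simp: subst_word_def)
  have "[] \<notin> set ws"
    using ws(2) image_not_Nil by (auto simp: list_all2_conv_all_nth in_set_conv_nth)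
  then show thesis using that ws by blast
qed

text \<open>Choose an image \<open>u\<close> of \<open>V\<close> and surround it by context of the length demanded by its radius, taken from
the image of a longer legal word.  In that word \<open>u\<close> is induced to split exactly along \<open>V\<close>, so by
uniqueness it does so at every occurrence of \<open>l @ u @ r\<close>: the preimage contains \<open>V\<close>, and a cut occurs
right after the image \<open>b\<close> of the first letter of \<open>V\<close>.\<close>

lemma recognised_factor:
  assumes rec: "locally_recognisable \<theta>" and V: "legal \<theta> V" "length V \<ge> 2"
  obtains u l r b where "u \<in> subst_word \<theta> V" "legal \<theta> (l @ u @ r)" "b \<in> \<theta> (hd V)"
    "\<And>ws z P S. legal \<theta> z \<Longrightarrow> list_all2 (\<lambda>w a. w \<in> \<theta> a) ws z \<Longrightarrow>
        concat ws = P @ (l @ u @ r) @ S \<Longrightarrow>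
        \<exists>k z2. z = take k z @ V @ z2 \<and> piece_start ws (Suc k) = length (P @ l @ b)"
proof -
  obtain u where u: "u \<in> subst_word \<theta> V" using subst_word_exists by blast
  then obtain B where B: "u = concat B" "list_all2 (\<lambda>w a. w \<in> \<theta> a) B V" "[] \<notin> set B"
    by (rule subst_word_pieces)
  have BV: "length B = length V" using B(2) by (rule list_all2_lengthD)
  have "legal \<theta> u" using legal_subst_word V(1) u .
  then have "recognisable \<theta> u" using rec by (auto simp: locally_recognisable_def)
  then obtain N where N: "recognisable_within \<theta> N u" by (auto simp: recognisable_def)
  obtain L R where LR: "length L = N" "length R = N" "legal \<theta> (L @ V @ R)"
    using legal_extend_by[OF V(1)] by blast
  obtain wL wR where w: "wL \<in> subst_word \<theta> L" "wR \<in> subst_word \<theta> R"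
    using subst_word_exists by metis
  obtain A where A: "wL = concat A" "list_all2 (\<lambda>w a. w \<in> \<theta> a) A L" "[] \<notin> set A"
    using w(1) by (rule subst_word_pieces)
  obtain C where C: "wR = concat C" "list_all2 (\<lambda>w a. w \<in> \<theta> a) C R" "[] \<notin> set C"
    using w(2) by (rule subst_word_pieces)
  have len: "length wL \<ge> N" "length wR \<ge> N"
    using subst_word_length_ge w LR by force+
  define p where "p = take (length wL - N) wL"
  define l where "l = drop (length wL - N) wL"
  define r where "r = take N wR"
  define s where "s = drop N wR"
  have pl: "wL = p @ l" and rs: "wR = r @ s" and lr: "length l = N" "length r = N"
    using len by (auto simp: p_def l_def r_def s_def)
  have ABC: "concat (A @ B @ C) = p @ (l @ u @ r) @ s"
    using A(1) B(1) C(1) pl rs by simp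
  have u0: "u \<noteq> []" using \<open>legal \<theta> u\<close> by (rule legal_not_Nil)
  then have u1: "length u \<ge> 1" by (cases u) auto
  have lABC: "legal \<theta> (concat (A @ B @ C))"
    using legal_subst_word[OF LR(3)] w u subst_word_append A(1) B(1) C(1) by (metis concat_append)
  have lW: "legal \<theta> (l @ u @ r)"
    using legal_sublist[OF lABC] ABC u0 by (metis append_is_Nil_conv sublist_appendI)
  have "inflation_decomposition \<theta> (concat (A @ B @ C)) (A @ B @ C, L @ V @ R)"
    using A B C LR(3) lABC by (intro full_decomposition) (auto intro: list_all2_appendI)
  then obtain us0 v0 where D0: "inflation_decomposition \<theta> (l @ u @ r) (us0, v0)"
    "\<And>i j. i \<le> j \<Longrightarrow> j < length (l @ u @ r) \<Longrightarrow>
        induced_decomposition (A @ B @ C, L @ V @ R) (length p + i) (length p + j) =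
        induced_decomposition (us0, v0) i j"
    using decomposition_of_factor[of \<theta> p "l @ u @ r" s] u0 unfolding ABC by blast
  have "induced_decomposition (us0, v0) N (N + length u - 1) =
      induced_decomposition (A @ B @ C, L @ V @ R) (length p + N) (length p + (N + length u - 1))"
    using u1 lr by (intro D0(2)[symmetric]) auto
  also have "length p + N = length (concat A)"
    using pl lr(1) A(1) by (metis length_append)
  also have "length p + (N + length u - 1) = length (concat A) + length (concat B) - 1"
    using \<open>length p + N = length (concat A)\<close> u1 B(1) by simp
  also have "induced_decomposition (A @ B @ C, L @ V @ R) (length (concat A)) \<dots> = (B, V)"
    using B(3) V(2) BV list_all2_lengthD[OF A(2)] by (intro induced_block) auto
  finally have ind0: "induced_decomposition (us0, v0) N (N + length u - 1) = (B, V)" .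
  show thesis
  proof (rule that[OF u lW])
    show "hd B \<in> \<theta> (hd V)" using B(2) V(2) by (cases B; cases V) auto
    fix ws z P S
    assume z: "legal \<theta> z" and ws: "list_all2 (\<lambda>w a. w \<in> \<theta> a) ws z"
      and cw: "concat ws = P @ (l @ u @ r) @ S"
    have "legal \<theta> (concat ws)" using legal_subst_word[OF z] ws by (auto simp: subst_word_def)
    moreover have "[] \<notin> set ws"
      using ws image_not_Nil by (auto simp: list_all2_conv_all_nth in_set_conv_nth)
    ultimately have "inflation_decomposition \<theta> (concat ws) (ws, z)"
      using z ws by (intro full_decomposition)
    then obtain us1 v1 where D1: "inflation_decomposition \<theta> (l @ u @ r) (us1, v1)"
      "\<And>i j. i \<le> j \<Longrightarrow> j < length (l @ u @ r) \<Longrightarrow>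
        induced_decomposition (ws, z) (length P + i) (length P + j) =
        induced_decomposition (us1, v1) i j"
      using decomposition_of_factor[of \<theta> P "l @ u @ r" S] u0 unfolding cw by blast
    have "induced_decomposition (ws, z) (length P + N) (length P + (N + length u - 1)) =
        induced_decomposition (us1, v1) N (N + length u - 1)"
      using u1 lr by (intro D1(2)) auto
    also have "\<dots> = (B, V)"
      using N D0(1) D1(1) lr lW ind0 unfolding recognisable_within_def by metis
    finally have ind: "induced_decomposition (ws, z) (length P + N)
        (length P + (N + length u - 1)) = (B, V)" .
    obtain k z2 where "z = take k z @ V @ z2" "piece_start ws (Suc k) = length P + N + length (hd B)"
      by (rule induced_block_unique[OF ind V(2)])
        (use u1 lr cw list_all2_lengthD[OF ws] in auto)
    then show "\<exists>k z2. z = take k z @ V @ z2 \<and> piece_start ws (Suc k) = length (P @ l @ hd B)"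
      using lr by auto
  qed
qed

text \<open>Some legal word \<open>W\<close> carries a cut of level \<open>n\<close> at one fixed offset \<open>q\<close> wherever it occurs.  The induction
goes up one level at a time: if \<open>W\<close> marks level \<open>n\<close>, a recognised image of \<open>[a] @ W @ [b]\<close> exhibits \<open>W\<close> in
the one-step preimage, and the level \<open>n\<close> cut there inflates to a level \<open>n + 1\<close> cut here.  The letter \<open>a\<close>
is included because only the end of its image is known to be a cut.\<close>

lemma forced_cut:
  assumes rec: "locally_recognisable \<theta>"
  shows "\<exists>W q. legal \<theta> W \<and> q \<le> length W \<and>
     (\<forall>Y P S. legal \<theta> Y \<longrightarrow> P @ W @ S \<in> iterate \<theta> n Y \<longrightarrow>
        (\<exists>Y1 Y2. Y = Y1 @ Y2 \<and> weight (inflation_length \<theta> n) Y1 = length P + q))"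
proof (induction n)
  case 0
  have "weight (inflation_length \<theta> 0) P = length P" for P
    using length_iterate[of P 0 P] by simp
  then show ?case using legal_letter by (intro exI[of _ "[undefined]"] exI[of _ 0]) auto
next
  case (Suc n)
  then obtain W q where W: "legal \<theta> W" "q \<le> length W"
    and cut: "\<And>Y P S. legal \<theta> Y \<Longrightarrow> P @ W @ S \<in> iterate \<theta> n Y \<Longrightarrow>
        \<exists>Y1 Y2. Y = Y1 @ Y2 \<and> weight (inflation_length \<theta> n) Y1 = length P + q"
    by blast
  obtain a b where ab: "legal \<theta> ([a] @ W @ [b])" using legal_extend[OF W(1)] by blast
  obtain u l r h where u: "u \<in> subst_word \<theta> ([a] @ W @ [b])" "legal \<theta> (l @ u @ r)" "h \<in> \<theta> a"
    and force: "\<And>ws z P S. legal \<theta> z \<Longrightarrow> list_all2 (\<lambda>w a. w \<in> \<theta> a) ws z \<Longrightarrow>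
        concat ws = P @ (l @ u @ r) @ S \<Longrightarrow>
        \<exists>k z2. z = take k z @ ([a] @ W @ [b]) @ z2 \<and> piece_start ws (Suc k) = length (P @ l @ h)"
    by (rule recognised_factor[OF rec ab]) auto
  let ?L = "weight (inflation_length \<theta> (Suc 0))"
  have h: "length h = ?L [a]" using length_subst_word[of h "[a]"] u(3) by (auto simp: subst_word_Cons)
  have lu: "length u = ?L ([a] @ take q W @ drop q W @ [b])"
    using length_subst_word[OF u(1)] by (simp only: append_assoc[symmetric] append_take_drop_id)
  define q' where "q' = length l + length h + ?L (take q W)"
  have "q' \<le> length (l @ u @ r)" unfolding q'_def h using lu by simp
  moreover have "\<exists>Y1 Y2. Y = Y1 @ Y2 \<and> weight (inflation_length \<theta> (Suc n)) Y1 = length P + q'"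
    if Y: "legal \<theta> Y" and Z: "P @ (l @ u @ r) @ S \<in> iterate \<theta> (Suc n) Y" for Y P S
  proof -
    obtain z where z: "z \<in> iterate \<theta> n Y" "P @ (l @ u @ r) @ S \<in> subst_word \<theta> z"
      using Z by (auto simp: iterate_Suc)
    obtain ws where ws: "P @ (l @ u @ r) @ S = concat ws" "list_all2 (\<lambda>w a. w \<in> \<theta> a) ws z"
      using z(2) by (rule subst_word_pieces)
    have lz: "legal \<theta> z" using legal_substitute[OF Y z(1)] .
    obtain k z2 where k: "z = take k z @ ([a] @ W @ [b]) @ z2"
      "piece_start ws (Suc k) = length (P @ l @ h)"
      using force[OF lz ws(2)] ws(1) by metis
    define P' where "P' = take k z @ [a]"
    have zP: "z = P' @ W @ [b] @ z2" using k(1) by (simp add: P'_def)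
    have "k < length z"
      using k(1) by (metis append_Cons append_Nil append_self_conv list.distinct(1) not_le take_all)
    then have "P' = take (Suc k) z"
      unfolding P'_def by (subst (2) k(1)) (simp add: take_Suc_conv_app_nth min_def)
    moreover have "concat (take (Suc k) ws) \<in> subst_word \<theta> (take (Suc k) z)"
      unfolding subst_word_def using list_all2_takeI[OF ws(2)] by blast
    ultimately have "?L P' = length (P @ l @ h)"
      using k(2) length_subst_word by (simp add: piece_start_def)
    obtain Y1 Y2 where Y12: "Y = Y1 @ Y2" "weight (inflation_length \<theta> n) Y1 = length P' + q"
      using cut[OF Y] z(1) zP by metis
    obtain z1 z3 where z13: "z = z1 @ z3" "z1 \<in> iterate \<theta> n Y1"
      using z(1) unfolding Y12(1) iterate_append by blast
    have "length z1 = length (P' @ take q W)" using length_iterate[OF z13(2)] Y12(2) W(2) by simp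
    moreover have "z1 @ z3 = (P' @ take q W) @ (drop q W @ [b] @ z2)"
      using z13(1) zP append_take_drop_id[of q W] by (metis append.assoc)
    ultimately have z1: "z1 = P' @ take q W" by (metis append_eq_append_conv)
    obtain w where w: "w \<in> subst_word \<theta> z1" using subst_word_exists by blast
    then have "w \<in> iterate \<theta> (Suc n) Y1" using z13(2) by (auto simp: iterate_Suc)
    from length_iterate[OF this] have "weight (inflation_length \<theta> (Suc n)) Y1 = ?L z1"
      using length_subst_word[OF w] by simp
    also have "\<dots> = length P + q'"
      using \<open>?L P' = length (P @ l @ h)\<close> by (simp add: z1 q'_def)
    finally show ?thesis using Y12(1) by blast
  qed
  ultimately show ?case using u(2) by blast
qed

text \<open>Two forced cuts are separated by a sum of inflated lengths, so any two occurrences of the marker word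
are at a distance divisible by the gcd.  Mixing produces two consecutive distances.\<close>

theorem mixing_imp_Gcd_inflation_length:
  assumes rec: "locally_recognisable \<theta>" and mix: "topologically_mixing (RS_subshift \<theta>)"
  shows "Gcd (range (\<lambda>a. inflation_length \<theta> n a)) = 1"
proof -
  define g where "g = Gcd (range (\<lambda>a. inflation_length \<theta> n a))"
  have g: "g dvd weight (inflation_length \<theta> n) Y" for Y
    by (rule weight_dvd) (auto simp: g_def)
  obtain W q where W: "legal \<theta> W"
    and cut: "\<And>Y P S. legal \<theta> Y \<Longrightarrow> P @ W @ S \<in> iterate \<theta> n Y \<Longrightarrow>
        \<exists>Y1 Y2. Y = Y1 @ Y2 \<and> weight (inflation_length \<theta> n) Y1 = length P + q"
    using forced_cut[OF rec, of n] by blast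
  obtain N where N: "\<And>m. m \<ge> N \<Longrightarrow> \<exists>w. length w = m \<and> legal \<theta> (W @ w @ W)"
    using mix W unfolding topologically_mixing_def language_subshift by blast
  have dvd: "g dvd length W + m" if m: "m \<ge> N" for m
  proof -
    obtain w where w: "length w = m" "legal \<theta> (W @ w @ W)" using N[OF m] by blast
    obtain k where k: "\<And>c. \<exists>p s. p @ (W @ w @ W) @ s \<in> iterate \<theta> (k + n) [c]"
      using occurs_in_iterates[OF w(2)] by (metis le_add1)
    obtain p s where ps: "p @ (W @ w @ W) @ s \<in> iterate \<theta> (k + n) [undefined]" using k by blast
    then obtain Y where Y: "Y \<in> iterate \<theta> k [undefined]" "p @ (W @ w @ W) @ s \<in> iterate \<theta> n Y"
      by (auto simp: iterate_add)
    have lY: "legal \<theta> Y" using legal_substitute[OF legal_letter Y(1)] .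
    obtain Y1 where 1: "weight (inflation_length \<theta> n) Y1 = length p + q"
      using cut[OF lY, of p "w @ W @ s"] Y(2) by auto
    obtain Y2 where 2: "weight (inflation_length \<theta> n) Y2 = length (p @ W @ w) + q"
      using cut[OF lY, of "p @ W @ w" s] Y(2) by auto
    have "g dvd (length (p @ W @ w) + q) - (length p + q)"
      using g[of Y1] g[of Y2] unfolding 1 2 by (rule dvd_diff_nat[rotated])
    then show ?thesis using w(1) by simp
  qed
  have "g dvd (length W + Suc N) - (length W + N)"
    using dvd[of N] dvd[of "Suc N"] by (intro dvd_diff_nat) auto
  then show ?thesis by (simp add: g_def)
qed

end

section \<open>Discrepancy of letter counts\<close>

text \<open>Two growth comparisons: \<open>|m| < r\<close> makes the second eigenfunctional negligible on average, and
\<open>|m| > 1\<close> makes it outgrow every bound that is linear in the number of scales.\<close>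

lemma exp_beats_affine:
  fixes A B C \<mu> r :: real
  assumes "A > 0" "0 \<le> \<mu>" "\<mu> < r" "r > 1"
  shows "\<exists>k. \<mu> ^ k * B + C < A * r ^ k"
proof -
  have 1: "(\<lambda>k. B * (\<mu> / r) ^ k + C * (1 / r) ^ k) \<longlonglongrightarrow> B * 0 + C * 0"
    using assms by (intro tendsto_intros LIMSEQ_power_zero) auto
  then have "\<forall>\<^sub>F k in sequentially. B * (\<mu> / r) ^ k + C * (1 / r) ^ k < A"
    using assms(1) by (intro order_tendstoD(2)[OF 1]) simp
  then obtain k where "B * (\<mu> / r) ^ k + C * (1 / r) ^ k < A"
    by (auto simp: eventually_sequentially)
  then have "(B * (\<mu> / r) ^ k + C * (1 / r) ^ k) * r ^ k < A * r ^ k"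
    using assms by (intro mult_strict_right_mono) auto
  moreover have "(B * (\<mu> / r) ^ k + C * (1 / r) ^ k) * r ^ k = \<mu> ^ k * B + C"
    using assms by (simp add: power_divide field_simps)
  ultimately show ?thesis by auto
qed

lemma exp_beats_linear:
  fixes A B C m :: real
  assumes "A > 0" "m > 1"
  shows "\<exists>q::nat. C + real q * B < m ^ q * A"
proof -
  have "(\<lambda>q. (C + real q * B) / m ^ q) \<longlonglongrightarrow> 0"
    using assms by real_asymp
  then have "\<forall>\<^sub>F q in sequentially. (C + real q * B) / m ^ q < A"
    using assms(1) by (rule order_tendstoD(2))
  then obtain q where "(C + real q * B) / m ^ q < A"
    by (auto simp: eventually_sequentially)
  then show ?thesis using assms by (auto simp: field_simps)
qed

lemma append_eq_append_prefix_cases: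
  assumes "p @ s = p' @ s'"
  obtains d where "p' = p @ d" | d where "p = p' @ d"
  using assms by (auto simp: append_eq_append_conv2)

context primitive_random_substitution
begin

lemma legal_extend_right:
  assumes "legal \<theta> w"
  shows "\<exists>e. length e = n \<and> legal \<theta> (w @ e)"
proof -
  obtain l e where "length e = n" "legal \<theta> (l @ w @ e)" using legal_extend_by[OF assms] by blast
  then show ?thesis using legal_sublist[of \<theta> "l @ w @ e" "w @ e"] legal_not_Nil[OF assms] by auto
qed

lemma legal_prefix: "legal \<theta> (w @ e) \<Longrightarrow> w \<noteq> [] \<Longrightarrow> legal \<theta> w"
  by (rule legal_sublist) auto

lemma legal_suffix: "legal \<theta> (w @ e) \<Longrightarrow> e \<noteq> [] \<Longrightarrow> legal \<theta> e"
  by (rule legal_sublist) auto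

lemma weight_iterate:
  fixes f :: "'a \<Rightarrow> real"
  assumes "\<And>a w. w \<in> \<theta> a \<Longrightarrow> weight f w = c * f a"
  shows "w \<in> iterate \<theta> n v \<Longrightarrow> weight f w = c ^ n * weight f v"
proof (induction n arbitrary: w)
  case (Suc n)
  then obtain z where z: "z \<in> iterate \<theta> n v" "w \<in> subst_word \<theta> z" by (auto simp: iterate_Suc)
  have "weight f w = weight (\<lambda>a. c * f a) z" using weight_subst_word[OF assms z(2)] .
  also have "\<dots> = c * weight f z" by (simp add: sum_list_const_mult)
  finally show ?case using Suc.IH[OF z(1)] by simp
qed simp

end

text \<open>The functional \<open>T\<close> is a left Perron--Frobenius eigenvector and measures the natural length, which
substitution multiplies exactly by \<open>r\<close>; \<open>\<phi>\<close> is a left eigenvector for the second eigenvalue and measures the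
deviation of letter counts from their average.  Working with \<open>T\<close> instead of the number of letters
avoids error terms that would depend on \<open>\<phi>\<close>.\<close>

locale expanding_weights = primitive_random_substitution \<theta> for \<theta> :: "'a::finite \<Rightarrow> 'a list set" +
  fixes x y :: 'a and T \<phi> :: "'a \<Rightarrow> real" and r m :: real
  assumes letters: "UNIV = {x, y}" "x \<noteq> y"
    and eigen_T: "w \<in> \<theta> a \<Longrightarrow> weight T w = r * T a"
    and eigen_\<phi>: "w \<in> \<theta> a \<Longrightarrow> weight \<phi> w = m * \<phi> a"
    and T_pos: "T a > 0"
    and \<phi>_x: "\<phi> x > 0" and \<phi>_y: "\<phi> y < 0"
    and m: "1 < \<bar>m\<bar>" "\<bar>m\<bar> < r"
begin

definition tmax :: real where "tmax = max (T x) (T y)"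
text \<open>A Lipschitz constant of \<open>\<phi>\<close> with respect to natural length.\<close>

definition slope :: real where "slope = \<bar>\<phi> x\<bar> / T x + \<bar>\<phi> y\<bar> / T y"

lemma letter_cases: "a = x \<or> a = y"
  using letters by auto

lemma r_gt_1: "r > 1" using m by linarith

lemma T_le_tmax: "T a \<le> tmax"
  using letter_cases[of a] by (auto simp: tmax_def)

lemma tmax_pos: "tmax > 0"
  using T_le_tmax[of x] T_pos[of x] by linarith

lemma slope_nonneg: "slope \<ge> 0"
  using T_pos by (simp add: slope_def less_imp_le)

lemma weight_T_nonneg: "weight T w \<ge> 0"
  by (induction w) (use T_pos in \<open>auto simp: less_imp_le add_nonneg_nonneg\<close>)

lemma weight_T_pos: "w \<noteq> [] \<Longrightarrow> weight T w > 0"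
  by (cases w) (use T_pos weight_T_nonneg in \<open>auto simp: add_pos_nonneg\<close>)

lemma weight_T_le: "weight T w \<le> tmax * real (length w)"
  by (induction w) (use T_le_tmax in \<open>auto simp: algebra_simps add_mono\<close>)

lemma abs_weight_\<phi>_le: "\<bar>weight \<phi> w\<bar> \<le> slope * weight T w"
proof (induction w)
  case (Cons a w)
  have "\<bar>\<phi> a\<bar> \<le> slope * T a"
    using letter_cases[of a] T_pos[of x] T_pos[of y] by (auto simp: slope_def algebra_simps)
  then show ?case using Cons by (simp add: algebra_simps)
qed simp

lemma prefix_of_weight:
  assumes "0 \<le> \<tau>" "\<tau> \<le> weight T w" "w \<noteq> []"
  shows "\<exists>w1 w2. w = w1 @ w2 \<and> w1 \<noteq> [] \<and> \<tau> \<le> weight T w1 \<and> weight T w1 \<le> \<tau> + tmax"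
  using assms
proof (induction w rule: rev_induct)
  case (snoc a v)
  show ?case
  proof (cases "v \<noteq> [] \<and> \<tau> \<le> weight T v")
    case True
    then show ?thesis using snoc.IH snoc.prems by (metis append.assoc)
  next
    case False
    then have "weight T v \<le> \<tau>" using snoc.prems(1) by auto
    then have "weight T (v @ [a]) \<le> \<tau> + tmax" using T_le_tmax[of a] by simp
    then show ?thesis using snoc.prems by (intro exI[of _ "v @ [a]"] exI[of _ "[]"]) auto
  qed
qed simp

lemma legal_extend_weight:
  assumes "legal \<theta> w"
  shows "\<exists>e. legal \<theta> (w @ e) \<and> \<tau> \<le> weight T (w @ e)"
proof -
  define t where "t = min (T x) (T y)"
  have t: "t > 0" using T_pos by (simp add: t_def)
  have le: "t * real (length v) \<le> weight T v" for v
  proof (induction v)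
    case (Cons a v)
    have "t \<le> T a" using letter_cases[of a] by (auto simp: t_def)
    then show ?case using Cons by (simp add: algebra_simps)
  qed simp
  obtain n where n: "\<tau> < real n * t" using t ex_less_of_nat_mult by blast
  obtain e where e: "length e = n" "legal \<theta> (w @ e)" using legal_extend_right[OF assms] by blast
  then show ?thesis using n le[of e] weight_T_nonneg[of w]
    by (intro exI[of _ e]) (auto simp: mult.commute)
qed

lemma prefixes_close:
  assumes "p @ s = p' @ s'"
  shows "\<bar>weight \<phi> p - weight \<phi> p'\<bar> \<le> slope * \<bar>weight T p - weight T p'\<bar>"
  using assms
proof (cases rule: append_eq_append_prefix_cases)
  case (1 d)
  then show ?thesis using abs_weight_\<phi>_le[of d] weight_T_nonneg[of d] by simp
next
  case (2 d)
  then show ?thesis using abs_weight_\<phi>_le[of d] weight_T_nonneg[of d] by simp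
qed

lemma adjust_weight:
  assumes "legal \<theta> w" "0 \<le> \<tau>"
  obtains w' where "legal \<theta> w'" "\<tau> \<le> weight T w'" "weight T w' \<le> \<tau> + tmax"
    "\<bar>weight \<phi> w - weight \<phi> w'\<bar> \<le> slope * (\<bar>weight T w - \<tau>\<bar> + tmax)"
proof -
  obtain e where e: "legal \<theta> (w @ e)" "\<tau> \<le> weight T (w @ e)"
    using legal_extend_weight[OF assms(1)] by blast
  obtain w' s where w': "w @ e = w' @ s" "w' \<noteq> []" "\<tau> \<le> weight T w'" "weight T w' \<le> \<tau> + tmax"
    using prefix_of_weight[OF assms(2) e(2) legal_not_Nil[OF e(1)]] by blast
  have "legal \<theta> w'" using e(1) w'(1,2) legal_prefix by metis
  moreover have "\<bar>weight T w - weight T w'\<bar> \<le> \<bar>weight T w - \<tau>\<bar> + tmax"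
    using w'(3,4) by linarith
  then have "\<bar>weight \<phi> w - weight \<phi> w'\<bar> \<le> slope * (\<bar>weight T w - \<tau>\<bar> + tmax)"
    using prefixes_close[OF w'(1)] slope_nonneg by (meson mult_left_mono order_trans)
  ultimately show thesis using that w'(3,4) by blast
qed

text \<open>The window of width \<open>tmax\<close> is as wide as the longest letter, so every long enough word has a prefix
inside it.\<close>

definition bounded_at :: "real \<Rightarrow> real \<Rightarrow> bool" where
  "bounded_at \<tau> B \<longleftrightarrow>
     (\<forall>w. legal \<theta> w \<and> \<tau> \<le> weight T w \<and> weight T w \<le> \<tau> + tmax \<longrightarrow> \<bar>weight \<phi> w\<bar> \<le> B)"

text \<open>The change of \<open>\<phi>\<close> when a word of natural length in \<open>[\<tau>, \<tau> + r * tmax]\<close> is replaced by one in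
\<open>[\<tau>, \<tau> + tmax]\<close>.\<close>

definition loss :: real where "loss = slope * (r * tmax + tmax)"

text \<open>Inflating a word multiplies \<open>\<phi>\<close> by \<open>m\<close>, so a bound at scale \<open>\<tau>\<close> improves by the factor \<open>|m|\<close> at scale
\<open>\<tau> / r\<close>, up to the constant cost of adjusting the inflated word.\<close>

lemma bounded_at_descend:
  assumes b: "bounded_at \<tau> B" and \<tau>: "\<tau> \<ge> 0"
  shows "bounded_at (\<tau> / r) ((B + loss) / \<bar>m\<bar>)"
  unfolding bounded_at_def
proof (intro allI impI)
  fix w assume w: "legal \<theta> w \<and> \<tau> / r \<le> weight T w \<and> weight T w \<le> \<tau> / r + tmax"
  obtain z where z: "z \<in> iterate \<theta> 1 w" using iterate_exists by blast
  have lz: "legal \<theta> z" using legal_substitute w z by blast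
  have Tz: "weight T z = r * weight T w" and \<phi>z: "weight \<phi> z = m * weight \<phi> w"
    using weight_iterate[OF eigen_T z] weight_iterate[OF eigen_\<phi> z] by auto
  have "\<tau> \<le> weight T z" "weight T z \<le> \<tau> + r * tmax"
    using w r_gt_1 unfolding Tz by (auto simp: field_simps)
  then have d: "\<bar>weight T z - \<tau>\<bar> \<le> r * tmax" by linarith
  obtain z' where z': "legal \<theta> z'" "\<tau> \<le> weight T z'" "weight T z' \<le> \<tau> + tmax"
    "\<bar>weight \<phi> z - weight \<phi> z'\<bar> \<le> slope * (\<bar>weight T z - \<tau>\<bar> + tmax)"
    using adjust_weight[OF lz \<tau>] .
  have "slope * (\<bar>weight T z - \<tau>\<bar> + tmax) \<le> loss"
    unfolding loss_def using d slope_nonneg by (intro mult_left_mono) auto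
  moreover have "\<bar>weight \<phi> z'\<bar> \<le> B" using b z' by (auto simp: bounded_at_def)
  ultimately have "\<bar>weight \<phi> z\<bar> \<le> B + loss" using z'(4) by linarith
  then show "\<bar>weight \<phi> w\<bar> \<le> (B + loss) / \<bar>m\<bar>"
    using m by (simp add: \<phi>z abs_mult field_simps)
qed

text \<open>The affine map \<open>B \<mapsto> (B + loss) / |m|\<close> contracts to its fixed point \<open>loss / (|m| - 1)\<close>, so any bound above the
fixed point persists at all smaller scales.\<close>

lemma bounded_at_all_scales:
  assumes b: "bounded_at \<tau> B" and \<tau>: "\<tau> \<ge> 0" and B: "loss / (\<bar>m\<bar> - 1) \<le> B"
  shows "bounded_at (\<tau> / r ^ k) B"
proof (induction k)
  case (Suc k)
  have "\<tau> / r ^ k \<ge> 0" using \<tau> r_gt_1 by simp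
  from bounded_at_descend[OF Suc this]
  have "bounded_at (\<tau> / r ^ Suc k) ((B + loss) / \<bar>m\<bar>)" by (simp add: field_simps)
  moreover have "(B + loss) / \<bar>m\<bar> \<le> B" using B m by (simp add: field_simps)
  ultimately show ?case unfolding bounded_at_def by (meson order_trans)
qed (use b in simp)

lemma cut_into_pieces:
  assumes b: "bounded_at \<sigma> B" and \<sigma>: "\<sigma> > 0" and "B \<ge> 0" "D \<ge> 0"
    and D: "\<And>w. legal \<theta> w \<Longrightarrow> weight T w \<le> \<sigma> \<Longrightarrow> \<bar>weight \<phi> w\<bar> \<le> D"
  shows "w = [] \<or> legal \<theta> w \<Longrightarrow> weight T w \<le> real N * \<sigma> \<Longrightarrow> \<bar>weight \<phi> w\<bar> \<le> real N * B + D"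
proof (induction N arbitrary: w)
  case 0
  then have "w = []" using weight_T_pos[of w] by auto
  then show ?case using assms by simp
next
  case (Suc N)
  show ?case
  proof (cases "w = [] \<or> weight T w \<le> \<sigma>")
    case True
    then have "\<bar>weight \<phi> w\<bar> \<le> D" using Suc.prems D assms(4) by auto
    then show ?thesis using assms(3) by (simp add: add_increasing)
  next
    case False
    then obtain w1 w2 where w: "w = w1 @ w2" "w1 \<noteq> []" "\<sigma> \<le> weight T w1" "weight T w1 \<le> \<sigma> + tmax"
      using prefix_of_weight[of \<sigma> w] \<sigma> by auto
    have lw: "legal \<theta> (w1 @ w2)" using Suc.prems False w(1) by auto
    have "\<bar>weight \<phi> w1\<bar> \<le> B"
      using b w legal_prefix[OF lw] by (auto simp: bounded_at_def)
    moreover have "weight T w2 \<le> real N * \<sigma>"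
      using Suc.prems(2) w(1,3) by (simp add: algebra_simps)
    then have "\<bar>weight \<phi> w2\<bar> \<le> real N * B + D"
      using Suc.IH[of w2] legal_suffix[OF lw] by blast
    ultimately show ?thesis by (simp add: w(1) algebra_simps)
  qed
qed

text \<open>If \<open>\<phi>\<close> is bounded by the same \<open>B\<close> at all scales \<open>\<sigma> * r ^ i\<close>, a word is cut greedily into pieces of these
scales, boundedly many of each.  Hence \<open>\<phi>\<close> grows only linearly in the number of scales, that is,
logarithmically in the length.\<close>

lemma climb_scales:
  assumes b: "\<And>i. i \<le> k \<Longrightarrow> bounded_at (\<sigma> * r ^ i) B" and \<sigma>: "\<sigma> > 0" and B: "B \<ge> 0"
  shows "i \<le> k \<Longrightarrow> legal \<theta> w \<Longrightarrow> weight T w \<le> \<sigma> * r ^ i \<Longrightarrow>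
     \<bar>weight \<phi> w\<bar> \<le> slope * \<sigma> + real i * (real (nat \<lceil>r\<rceil>) * B)"
proof (induction i arbitrary: w)
  case 0
  then have "slope * weight T w \<le> slope * \<sigma>" using slope_nonneg by (intro mult_left_mono) auto
  then show ?case using abs_weight_\<phi>_le[of w] by simp
next
  case (Suc i)
  have s: "\<sigma> * r ^ i > 0" using \<sigma> r_gt_1 by simp
  have "r \<le> real (nat \<lceil>r\<rceil>)" by (rule real_nat_ceiling_ge)
  then have "\<sigma> * r ^ Suc i \<le> real (nat \<lceil>r\<rceil>) * (\<sigma> * r ^ i)"
    using s mult_right_mono[of r "real (nat \<lceil>r\<rceil>)" "\<sigma> * r ^ i"] by (simp add: mult.left_commute)
  then have "\<bar>weight \<phi> w\<bar> \<le> real (nat \<lceil>r\<rceil>) * B + (slope * \<sigma> + real i * (real (nat \<lceil>r\<rceil>) * B))"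
    using Suc.prems Suc.IH B slope_nonneg \<sigma>
    by (intro cut_into_pieces[OF b s]) (auto intro: order_trans)
  then show ?case by (simp add: algebra_simps)
qed

text \<open>If the functional were positive on all legal words of length \<open>n\<close>, it would grow linearly with the
length of a word; but on iterates of a letter it grows like \<open>m ^ k\<close>, which is of smaller order than
their length.  Applied to \<open>\<phi>\<close> and \<open>-\<phi>\<close>, this centres the values of \<open>\<phi>\<close> at \<open>0\<close>.\<close>

lemma weight_nonpositive_somewhere:
  fixes f :: "'a \<Rightarrow> real"
  assumes f: "\<And>a w. w \<in> \<theta> a \<Longrightarrow> weight f w = m * f a" and n: "n \<ge> 1"
  shows "\<exists>w. legal \<theta> w \<and> length w = n \<and> weight f w \<le> 0"
proof (rule ccontr)
  assume "\<not> ?thesis"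
  then have pos: "weight f w > 0" if "legal \<theta> w" "length w = n" for w using that by force
  define S where "S = (weight f) ` {w. legal \<theta> w \<and> length w = n}"
  have "finite {w :: 'a list. length w = n}"
    using finite_lists_length_eq[of "UNIV :: 'a set" n] by simp
  then have fin: "finite S" unfolding S_def by (intro finite_imageI) (rule finite_subset, auto)
  define \<epsilon> where "\<epsilon> = Min (insert 1 S)"
  have \<epsilon>: "\<epsilon> > 0" using fin pos by (auto simp: \<epsilon>_def S_def)
  have \<epsilon>_le: "\<epsilon> \<le> weight f w" if "legal \<theta> w" "length w = n" for w
    unfolding \<epsilon>_def using fin that by (intro Min_le) (auto simp: S_def)
  define K where "K = \<bar>f x\<bar> + \<bar>f y\<bar>"
  have K: "\<bar>weight f w\<bar> \<le> K * real (length w)" for w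
  proof (induction w)
    case (Cons a w)
    have "\<bar>f a\<bar> \<le> K" using letter_cases[of a] by (auto simp: K_def)
    then show ?case using Cons by (simp add: algebra_simps)
  qed simp
  have K0: "K \<ge> 0" by (simp add: K_def)
  have lower: "real q * \<epsilon> - K * real n \<le> weight f w"
    if "w = [] \<or> legal \<theta> w" "q * n \<le> length w" "length w \<le> q * n + n" for q w
    using that
  proof (induction q arbitrary: w)
    case 0
    have "K * real (length w) \<le> K * real n" using 0 K0 by (intro mult_left_mono) auto
    then show ?case using K[of w] by simp
  next
    case (Suc q)
    have lw: "legal \<theta> w" using Suc.prems n by auto
    have ln: "length (take n w) = n" using Suc.prems by simp
    have "take n w \<noteq> []" using ln n by auto
    then have "\<epsilon> \<le> weight f (take n w)"
      using ln \<epsilon>_le[of "take n w"] legal_sublist[OF lw, of "take n w"] by simp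
    moreover have "drop n w = [] \<or> legal \<theta> (drop n w)"
      using legal_sublist[OF lw, of "drop n w"] by auto
    then have "real q * \<epsilon> - K * real n \<le> weight f (drop n w)"
      using Suc.prems by (intro Suc.IH) auto
    moreover have "weight f w = weight f (take n w) + weight f (drop n w)"
      by (metis append_take_drop_id map_append sum_list_append)
    ultimately show ?case by (simp add: algebra_simps)
  qed
  define A where "A = \<epsilon> * (T x / (tmax * real n))"
  have "A > 0" using \<epsilon> T_pos tmax_pos n by (simp add: A_def)
  then obtain k where k: "\<bar>m\<bar> ^ k * \<bar>f x\<bar> + (\<epsilon> + K * real n) < A * r ^ k"
    using exp_beats_affine[of A "\<bar>m\<bar>" r] m by auto
  obtain w where w: "w \<in> iterate \<theta> k [x]" using iterate_exists by blast
  have lw: "legal \<theta> w" using legal_substitute legal_letter w by blast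
  define q where "q = length w div n"
  have q: "q * n \<le> length w" "length w \<le> q * n + n"
    using n mod_less_divisor[of n "length w"] div_mult_mod_eq[of "length w" n]
    unfolding q_def by linarith+
  have "r ^ k * T x \<le> tmax * real (length w)"
    using weight_T_le[of w] weight_iterate[OF eigen_T w] by simp
  also have "\<dots> \<le> tmax * (real (q * n + n))"
    using q(2) tmax_pos by (intro mult_left_mono) (simp_all only: of_nat_le_iff less_imp_le)
  finally have "r ^ k * T x / (tmax * real n) \<le> real q + 1"
    using tmax_pos n by (simp add: field_simps)
  then have "\<epsilon> * (r ^ k * T x / (tmax * real n)) \<le> \<epsilon> * (real q + 1)"
    using \<epsilon> by (intro mult_left_mono) auto
  then have "A * r ^ k \<le> real q * \<epsilon> + \<epsilon>" by (simp add: A_def algebra_simps)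
  also have "\<dots> \<le> weight f w + K * real n + \<epsilon>" using lower[OF _ q] lw by auto
  also have "weight f w \<le> \<bar>m\<bar> ^ k * \<bar>f x\<bar>"
    using weight_iterate[OF f w] by (simp flip: abs_mult power_abs)
  finally show False using k by linarith
qed

text \<open>This is where \<open>|m| > 1\<close> enters.  If letter counts of words of some large length \<open>n\<close> varied by less than
\<open>W\<close>, then \<open>\<phi>\<close> would be bounded on words of natural length about \<open>\<kappa> n\<close>, hence at all scales \<open>\<kappa> n / r ^ k\<close>
with a bound depending only on \<open>W\<close>, hence \<open>\<phi>\<close> would be at most linear in \<open>q\<close> on the \<open>q\<close>-th iterate of \<open>x\<close>.
There it equals \<open>m ^ q * \<phi> x\<close>, a contradiction as soon as \<open>n\<close> leaves room for enough scales.\<close>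

lemma unbounded_discrepancy:
  "\<exists>n0. \<forall>n\<ge>n0. \<exists>z1 z2. legal \<theta> z1 \<and> legal \<theta> z2 \<and> length z1 = n \<and> length z2 = n \<and>
     count_list z1 x + W \<le> count_list z2 x"
proof -
  define \<delta> where "\<delta> = \<phi> x - \<phi> y"
  have \<delta>: "\<delta> > 0" using \<phi>_x \<phi>_y by (simp add: \<delta>_def)
  define W' where "W' = real W * \<delta>"
  have W': "W' \<ge> 0" using \<delta> by (simp add: W'_def)
  \<comment> \<open>\<open>\<kappa>\<close> and \<open>\<zeta>\<close> solve \<open>T = \<kappa> + \<zeta> * \<phi>\<close> on letters: natural length is \<open>\<kappa>\<close> times length up to a multiple of \<open>\<phi>\<close>.\<close>
  define \<zeta> where "\<zeta> = (T x - T y) / \<delta>"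
  define \<kappa> where "\<kappa> = T x - \<zeta> * \<phi> x"
  have \<kappa>_eq: "\<kappa> = (T y * \<phi> x - T x * \<phi> y) / \<delta>"
    using \<delta> by (simp add: \<kappa>_def \<zeta>_def field_simps) (simp add: \<delta>_def algebra_simps)
  have "T y * \<phi> x > 0" "T x * \<phi> y < 0"
    using T_pos \<phi>_x \<phi>_y by (auto simp: mult_pos_neg)
  then have \<kappa>: "\<kappa> > 0" unfolding \<kappa>_eq using \<delta> by simp
  have "\<zeta> * \<delta> = T x - T y" using \<delta> by (simp add: \<zeta>_def)
  then have "\<zeta> * \<phi> x - \<zeta> * \<phi> y = T x - T y" by (simp add: \<delta>_def algebra_simps)
  then have "T a = \<kappa> + \<zeta> * \<phi> a" for a
    using letter_cases[of a] by (auto simp: \<kappa>_def)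
  then have T_\<phi>: "weight T w = \<kappa> * real (length w) + \<zeta> * weight \<phi> w" for w
    by (induction w) (auto simp: algebra_simps)
  have \<phi>_count: "weight \<phi> w = \<phi> y * real (length w) + \<delta> * real (count_list w x)" for w
  proof (induction w)
    case (Cons a w)
    then show ?case using letter_cases[of a] letters(2) by (auto simp: algebra_simps \<delta>_def)
  qed simp
  define B0 where "B0 = W' + slope * (tmax + \<bar>\<zeta>\<bar> * W')"
  define B where "B = max B0 (loss / (\<bar>m\<bar> - 1))"
  have "B0 \<ge> 0" using W' slope_nonneg tmax_pos by (simp add: B0_def)
  then have B: "B \<ge> 0" by (simp add: B_def)
  define P where "P = real (nat \<lceil>r\<rceil>) * B"
  obtain q0 where q0: "T x < r ^ q0" using real_arch_pow[OF r_gt_1] by blast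
  obtain q where q: "(slope * r + real q0 * P) + real q * P < \<bar>m\<bar> ^ q * \<phi> x"
    using exp_beats_linear[OF \<phi>_x m(1)] by blast
  obtain n0 where n0: "r ^ (q + q0 + 1) < real n0 * \<kappa>" using \<kappa> ex_less_of_nat_mult by blast
  show ?thesis
  proof (intro exI[of _ "max 1 n0"] allI impI)
    fix n assume n: "max 1 n0 \<le> n"
    then have n1: "n \<ge> 1" by simp
    have \<kappa>n: "r ^ (q + q0 + 1) < \<kappa> * real n"
    proof -
      have "real n0 * \<kappa> \<le> real n * \<kappa>" using n \<kappa> by (intro mult_right_mono) auto
      then show ?thesis using n0 by (simp add: mult.commute)
    qed
    show "\<exists>z1 z2. legal \<theta> z1 \<and> legal \<theta> z2 \<and> length z1 = n \<and> length z2 = n \<and>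
        count_list z1 x + W \<le> count_list z2 x"
    proof (rule ccontr)
      assume "\<not> ?thesis"
      then have near: "count_list z2 x \<le> count_list z1 x + W"
        if "legal \<theta> z1" "legal \<theta> z2" "length z1 = n" "length z2 = n" for z1 z2
        using that by (metis le_cases)
      then have osc: "weight \<phi> z2 \<le> weight \<phi> z1 + W'"
        if "legal \<theta> z1" "legal \<theta> z2" "length z1 = n" "length z2 = n" for z1 z2
      proof -
        have "real (count_list z2 x) \<le> real (count_list z1 x) + real W"
          using near[OF that] by linarith
        then have "\<delta> * real (count_list z2 x) \<le> \<delta> * (real (count_list z1 x) + real W)"
          using \<delta> by (intro mult_left_mono) auto
        then show ?thesis using that by (simp add: \<phi>_count W'_def algebra_simps)
      qed
      obtain lo where lo: "legal \<theta> lo" "length lo = n" "weight \<phi> lo \<le> 0"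
        using weight_nonpositive_somewhere[OF eigen_\<phi> n1] by blast
      have neg: "weight (\<lambda>a. - \<phi> a) w = - weight \<phi> w" for w by (induction w) auto
      have "weight (\<lambda>a. - \<phi> a) w = m * (- \<phi> a)" if "w \<in> \<theta> a" for a w
        using eigen_\<phi>[OF that] by (simp add: neg)
      then obtain hi where hi: "legal \<theta> hi" "length hi = n" "weight \<phi> hi \<ge> 0"
        using weight_nonpositive_somewhere[OF _ n1] by (metis neg neg_le_0_iff_le)
      have bd: "\<bar>weight \<phi> z\<bar> \<le> W'" if "legal \<theta> z" "length z = n" for z
        using osc[OF lo(1) that(1) lo(2) that(2)] osc[OF that(1) hi(1) that(2) hi(2)] lo(3) hi(3)
        by linarith
      have "bounded_at (\<kappa> * real n) B0"
        unfolding bounded_at_def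
      proof (intro allI impI)
        fix w assume w: "legal \<theta> w \<and> \<kappa> * real n \<le> weight T w \<and> weight T w \<le> \<kappa> * real n + tmax"
        obtain e where e: "length e = n" "legal \<theta> (w @ e)" using legal_extend_right w by blast
        define w' where "w' = take n (w @ e)"
        have lw': "length w' = n" using e by (simp add: w'_def)
        then have "w' \<noteq> []" using n1 by auto
        then have "legal \<theta> w'" using legal_prefix[of w' "drop n (w @ e)"] e(2) by (simp add: w'_def del: take_append drop_append)
        then have b': "\<bar>weight \<phi> w'\<bar> \<le> W'" using bd lw' by blast
        have "\<bar>weight T w' - \<kappa> * real n\<bar> = \<bar>\<zeta>\<bar> * \<bar>weight \<phi> w'\<bar>"
          using T_\<phi>[of w'] lw' by (simp add: abs_mult)
        also have "\<dots> \<le> \<bar>\<zeta>\<bar> * W'" using b' by (intro mult_left_mono) auto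
        finally have "\<bar>weight T w - weight T w'\<bar> \<le> tmax + \<bar>\<zeta>\<bar> * W'" using w by linarith
        then have "slope * \<bar>weight T w - weight T w'\<bar> \<le> slope * (tmax + \<bar>\<zeta>\<bar> * W')"
          using slope_nonneg by (intro mult_left_mono)
        moreover have "w @ e = w' @ drop n (w @ e)" by (simp add: w'_def del: take_append drop_append)
        then have "\<bar>weight \<phi> w - weight \<phi> w'\<bar> \<le> slope * \<bar>weight T w - weight T w'\<bar>"
          by (rule prefixes_close)
        ultimately show "\<bar>weight \<phi> w\<bar> \<le> B0" using b' unfolding B0_def by linarith
      qed
      then have "bounded_at (\<kappa> * real n) B"
        unfolding bounded_at_def B_def by (meson max.coboundedI1)
      then have all: "bounded_at (\<kappa> * real n / r ^ k) B" for k
        using \<kappa> by (intro bounded_at_all_scales) (auto simp: B_def)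
      \<comment> \<open>The smallest scale \<open>\<sigma>\<close> is normalised into \<open>[1, r]\<close>, so that the bound below is independent of \<open>n\<close>.\<close>
      define j where "j = (LEAST j. \<kappa> * real n < r ^ j)"
      have ex: "\<exists>j. \<kappa> * real n < r ^ j" using real_arch_pow[OF r_gt_1] by blast
      have j: "\<kappa> * real n < r ^ j" unfolding j_def using ex by (rule LeastI_ex)
      have "r ^ (q + q0 + 1) < r ^ j" using \<kappa>n j by linarith
      then have jq: "q + q0 + 1 < j" using r_gt_1 power_less_imp_less_exp by blast
      then obtain k where k: "j = Suc k" by (cases j) auto
      have k_le: "r ^ k \<le> \<kappa> * real n"
        using not_less_Least[of k "\<lambda>j. \<kappa> * real n < r ^ j"] k unfolding j_def by simp
      define \<sigma> where "\<sigma> = \<kappa> * real n / r ^ k"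
      have rk: "r ^ k > 0" using r_gt_1 by simp
      have \<sigma>: "1 \<le> \<sigma>" "\<sigma> \<le> r" using k_le j rk unfolding k \<sigma>_def by (simp_all add: field_simps)
      have "bounded_at (\<sigma> * r ^ i) B" if "i \<le> k" for i
      proof -
        have "\<sigma> * r ^ i = \<kappa> * real n / r ^ (k - i)"
          using that r_gt_1 by (simp add: \<sigma>_def power_diff)
        then show ?thesis using all by simp
      qed
      note climb = climb_scales[OF this]
      obtain w where w: "w \<in> iterate \<theta> q [x]" using iterate_exists by blast
      have "weight T w = r ^ q * T x" using weight_iterate[OF eigen_T w] by simp
      also have "\<dots> \<le> r ^ q * r ^ q0" using q0 r_gt_1 by (intro mult_left_mono) auto
      also have "\<dots> = r ^ (q + q0)" by (simp add: power_add)
      also have "\<dots> \<le> \<sigma> * r ^ (q + q0)" using \<sigma>(1) r_gt_1 by simp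
      finally have "\<bar>weight \<phi> w\<bar> \<le> slope * \<sigma> + real (q + q0) * P"
        unfolding P_def using \<sigma> B jq k legal_substitute[OF legal_letter w] by (intro climb) auto
      moreover have "slope * \<sigma> \<le> slope * r" using \<sigma> slope_nonneg by (intro mult_left_mono)
      moreover have "\<bar>weight \<phi> w\<bar> = \<bar>m\<bar> ^ q * \<phi> x"
        using weight_iterate[OF eigen_\<phi> w] \<phi>_x by (simp add: abs_mult power_abs)
      ultimately show False using q by (simp add: algebra_simps)
    qed
  qed
qed

end

section \<open>From discrepancy to mixing\<close>

text \<open>Every large \<open>L\<close> is a combination \<open>n * B + c * D\<close> with \<open>c\<close> in a window of fixed width above \<open>g n\<close>, as long as
\<open>g\<close> moves slowly.  The boundary value \<open>G n = n * B + g n * D\<close> increases in steps of at most \<open>B + D\<close>, so some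
\<open>N\<close> has \<open>G N\<close> just below \<open>L\<close>; going back by some \<open>s < D\<close> makes \<open>L - n * B\<close> divisible by \<open>D\<close>.\<close>

lemma lattice_strip:
  fixes g :: "nat \<Rightarrow> nat" and B D n0 :: nat
  assumes B: "B \<ge> 1" and cop: "coprime B D"
    and step: "\<And>n. n \<ge> n0 \<Longrightarrow> g n \<le> g (Suc n) \<and> g (Suc n) \<le> Suc (g n)"
  shows "\<exists>L0. \<forall>L\<ge>L0. \<exists>n\<ge>n0. \<exists>c\<ge>g n. c < g n + (D + 1) * (B + D) \<and> L = n * B + c * D"
proof (cases "D = 0")
  case True
  then have "B = 1" using cop by simp
  then show ?thesis using True by (intro exI[of _ n0]) auto
next
  case False
  define G where "G n = n * B + g n * D" for n
  have G_step: "G n \<le> G (Suc n) \<and> G (Suc n) \<le> G n + (B + D)" if "n \<ge> n0" for n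
  proof -
    have "g n * D \<le> g (Suc n) * D" "g (Suc n) * D \<le> Suc (g n) * D"
      using step[OF that] by (blast intro: mult_le_mono1)+
    then show ?thesis by (simp only: G_def mult_Suc) linarith
  qed
  have G_back: "G n \<le> G (n + s) \<and> G (n + s) \<le> G n + s * (B + D)" if "n \<ge> n0" for n s
  proof (induction s)
    case (Suc s)
    then show ?case using G_step[of "n + s"] that by simp
  qed simp
  show ?thesis
  proof (rule exI[of _ "G (n0 + D)"], intro allI impI)
    fix L assume L: "G (n0 + D) \<le> L"
    have bound: "n \<le> L" if "G n \<le> L" for n
    proof -
      have "n \<le> n * B" using B by (cases B) auto
      then show ?thesis using that unfolding G_def by linarith
    qed
    let ?Q = "\<lambda>n. n0 + D \<le> n \<and> G n \<le> L"
    define N where "N = Greatest ?Q"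
    have Q_bound: "n \<le> L" if "?Q n" for n using bound that by blast
    have "?Q (n0 + D)" using L by simp
    then have N: "?Q N" unfolding N_def using Q_bound by (rule GreatestI_nat)
    have "\<not> G (Suc N) \<le> L"
    proof
      assume "G (Suc N) \<le> L"
      then have "?Q (Suc N)" using N by simp
      then have "Suc N \<le> N" unfolding N_def using Q_bound by (rule Greatest_le_nat)
      then show False by simp
    qed
    then have up: "L < G N + (B + D)" using G_step[of N] N by linarith
    obtain u v :: int where uv: "u * int B + v * int D = 1"
      using bezout_int[of "int B" "int D"] cop by (auto simp: coprime_iff_gcd_eq_1)
    define E where "E = int L - int N * int B"
    \<comment> \<open>The residue \<open>s\<close> solves \<open>s * B \<equiv> - E (mod D)\<close>, since \<open>u\<close> inverts \<open>B\<close> modulo \<open>D\<close>.\<close>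
    define s where "s = nat ((- E * u) mod int D)"
    define t where "t = (- E * u) div int D"
    have s: "int s = - E * u - int D * t" "s < D"
      using False by (auto simp: s_def t_def minus_mult_div_eq_mod nat_less_iff)
    define c where "c = E * v - t * int B"
    have "E + int s * int B = E * (u * int B + v * int D) + int s * int B" by (simp add: uv)
    also have "\<dots> = c * int D" by (simp add: s(1) c_def algebra_simps)
    finally have Ec: "E + int s * int B = c * int D" .
    define n where "n = N - s"
    have n: "N = n + s" "n \<ge> n0" using N s(2) by (auto simp: n_def)
    have Lc: "int L = int n * int B + c * int D"
      using Ec by (simp add: E_def n(1) algebra_simps)
    have GN: "G n \<le> G N" "G N \<le> G n + s * (B + D)" using G_back[OF n(2), of s] n(1) by auto
    have "int (G n) \<le> int L" using GN(1) N by linarith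
    then have "int (g n) * int D \<le> c * int D" using Lc by (simp add: G_def)
    then have c1: "int (g n) \<le> c" using False by simp
    have "L < G n + (s + 1) * (B + D)" using up GN(2) by simp
    also have "(s + 1) * (B + D) \<le> D * (B + D)" using s(2) by (intro mult_right_mono) auto
    finally have "int L < int (G n) + int (D * (B + D))"
      by (simp only: of_nat_add[symmetric] of_nat_less_iff)
    then have "c * int D < (int (g n) + int (B + D)) * int D" using Lc by (simp add: G_def algebra_simps)
    then have c2: "c < int (g n) + int (B + D)" by (meson mult_right_less_imp_less of_nat_0_le_iff)
    have "nat c < g n + (D + 1) * (B + D)" using c1 c2 by simp
    moreover have "L = n * B + nat c * D"
      using Lc c1 by (simp flip: of_nat_eq_iff[where 'a = int])
    ultimately show "\<exists>n\<ge>n0. \<exists>c\<ge>g n. c < g n + (D + 1) * (B + D) \<and> L = n * B + c * D"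
      using n(2) c1 by (intro exI[of _ n] exI[of _ "nat c"] conjI) auto
  qed
qed

context primitive_random_substitution
begin

text \<open>Place \<open>u\<close> and \<open>v\<close> inside iterates, at a common level, of the two letters of a legal word of length two.\<close>

lemma legal_join:
  assumes "legal \<theta> u" "legal \<theta> v"
  shows "\<exists>w. legal \<theta> (u @ w @ v)"
proof -
  obtain k1 k2 where "\<forall>k\<ge>k1. \<forall>c. \<exists>p s. p @ u @ s \<in> iterate \<theta> k [c]"
    "\<forall>k\<ge>k2. \<forall>c. \<exists>p s. p @ v @ s \<in> iterate \<theta> k [c]"
    using occurs_in_iterates assms by meson
  moreover define k where "k = max k1 k2"
  ultimately have k: "\<exists>p s. p @ u @ s \<in> iterate \<theta> k [c]" "\<exists>p s. p @ v @ s \<in> iterate \<theta> k [c]" for c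
    by auto
  obtain a b where ab: "legal \<theta> ([a] @ [b])"
    using legal_extend_right[OF legal_letter[of undefined], of 1] by (auto simp: length_Suc_conv)
  obtain p s p' s' where "p @ u @ s \<in> iterate \<theta> k [a]" "p' @ v @ s' \<in> iterate \<theta> k [b]"
    using k by meson
  then have "legal \<theta> ((p @ u @ s) @ p' @ v @ s')"
    using legal_substitute[OF ab] iterate_appendI by blast
  then have "legal \<theta> (p @ (u @ (s @ p') @ v) @ s')" by simp
  then have "legal \<theta> (u @ (s @ p') @ v)"
    using legal_sublist legal_not_Nil[OF assms(1)] by (metis append_is_Nil_conv sublist_appendI)
  then show ?thesis by blast
qed

text \<open>Slide a window of length \<open>n\<close> from \<open>z1\<close> to \<open>z2\<close> through a legal word containing both.  The count of \<open>x\<close>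
changes by at most one per step, and at a step from \<open>c\<close> to \<open>c + 1\<close> the leaving letter must be \<open>y\<close> and
the entering letter \<open>x\<close>.  So both end letters come out fixed, independently of \<open>n\<close> and \<open>c\<close>.\<close>

lemma sliding_window:
  assumes letters: "UNIV = {x, y}" "x \<noteq> y"
    and z: "legal \<theta> z1" "legal \<theta> z2" "length z1 = n" "length z2 = n"
    and c: "count_list z1 x \<le> c" "c < count_list z2 x"
  shows "\<exists>w. legal \<theta> (y # w @ [x]) \<and> Suc (length w) = n \<and> count_list w x = c"
proof -
  obtain v where v: "legal \<theta> (z1 @ v @ z2)" using legal_join z(1,2) by blast
  define Z where "Z = z1 @ v @ z2"
  define f where "f t = count_list (take n (drop t Z)) x" for t
  define q where "q = length (z1 @ v)"
  have n0: "n > 0" using c(2) z(4) by (cases z2) auto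
  have f0: "f 0 \<le> c" using z(3) c(1) by (simp add: f_def Z_def)
  have fq: "c < f q" using z(4) c(2) by (simp add: f_def Z_def q_def)
  define t' where "t' = (LEAST t. c < f t)"
  have t': "c < f t'" unfolding t'_def using fq by (rule LeastI)
  have t'q: "t' \<le> q" unfolding t'_def using fq by (rule Least_le)
  obtain t where t: "t' = Suc t" using t' f0 by (cases t') auto
  have ft: "f t \<le> c" using not_less_Least[of t "\<lambda>t. c < f t"] t unfolding t'_def by simp
  have lZ: "t + n < length Z" using t'q t z(4) by (simp add: q_def Z_def)
  define w where "w = take (n - 1) (drop (Suc t) Z)"
  have lw: "Suc (length w) = n" using lZ n0 by (simp add: w_def)
  have w1: "take n (drop t Z) = Z ! t # w"
    using lZ n0 by (simp add: w_def Cons_nth_drop_Suc[symmetric] take_Cons')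
  have w2: "take n (drop (Suc t) Z) = w @ [Z ! (t + n)]"
    using lZ n0 take_Suc_conv_app_nth[of "n - 1" "drop (Suc t) Z"] by (simp add: w_def)
  have "Z ! (t + n) = x" "Z ! t \<noteq> x" "count_list w x = c"
    using ft t' unfolding t f_def w1 w2 by (auto split: if_splits)
  moreover from this have "Z ! t = y" using letters by auto
  moreover have "legal \<theta> (Z ! t # w @ [Z ! (t + n)])"
  proof -
    have "Z ! t # w @ [Z ! (t + n)] = Z ! t # take n (drop (Suc t) Z)" using w2 by simp
    also have "\<dots> = take (Suc n) (drop t Z)" using lZ by (simp add: Cons_nth_drop_Suc[symmetric])
    finally have "sublist (Z ! t # w @ [Z ! (t + n)]) Z"
      by (metis sublist_drop sublist_take sublist_order.order.trans)
    then show ?thesis using legal_sublist v by (auto simp: Z_def)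
  qed
  ultimately show ?thesis using lw by auto
qed

text \<open>Here \<open>g n\<close> is the least count of \<open>x\<close> in legal words of length \<open>n\<close>.  With \<open>A = B + D\<close> and \<open>B\<close> the inflated
lengths of \<open>x\<close> and \<open>y\<close>, a word of length \<open>n\<close> with \<open>c\<close> letters \<open>x\<close> inflates to length \<open>n * B + c * D\<close>; the
discrepancy makes every \<open>c\<close> in the required strip available.\<close>

lemma connecting_lengths:
  assumes letters: "UNIV = {x, y}" "x \<noteq> y"
    and disc: "\<And>W. \<exists>n0. \<forall>n\<ge>n0. \<exists>z1 z2. legal \<theta> z1 \<and> legal \<theta> z2 \<and> length z1 = n \<and> length z2 = n \<and>
      count_list z1 x + W \<le> count_list z2 x"
    and le: "inflation_length \<theta> k y \<le> inflation_length \<theta> k x"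
    and cop: "coprime (inflation_length \<theta> k x) (inflation_length \<theta> k y)"
  shows "\<exists>L0. \<forall>L\<ge>L0. \<exists>w. legal \<theta> ([y] @ w @ [x]) \<and> weight (inflation_length \<theta> k) ([y] @ w) = L"
proof -
  define B where "B = inflation_length \<theta> k y"
  define D where "D = inflation_length \<theta> k x - B"
  have A: "inflation_length \<theta> k x = B + D" using le by (simp add: B_def D_def)
  have B1: "B \<ge> 1" using inflation_length_pos[of k y] by (simp add: B_def)
  have "coprime B D" using cop unfolding A B_def[symmetric]
    by (simp add: coprime_iff_gcd_eq_1 gcd.commute)
  obtain n0 where n0: "\<And>n. n \<ge> n0 \<Longrightarrow> \<exists>z1 z2. legal \<theta> z1 \<and> legal \<theta> z2 \<and> length z1 = n \<and> length z2 = n \<and>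
      count_list z1 x + (D + 1) * (B + D) \<le> count_list z2 x"
    using disc by blast
  define n1 where "n1 = max 1 n0"
  let ?P = "\<lambda>n c. \<exists>z. legal \<theta> z \<and> length z = n \<and> count_list z x = c"
  define g where "g n = (LEAST c. ?P n c)" for n
  have attained: "?P n (g n)" if n: "n \<ge> n1" for n
  proof -
    have "\<exists>c. ?P n c" using n0[of n] n by (auto simp: n1_def)
    then show ?thesis unfolding g_def by (rule LeastI_ex)
  qed
  have least: "g (length z) \<le> count_list z x" if "legal \<theta> z" for z
    unfolding g_def using that by (intro Least_le) blast
  have step: "g n \<le> g (Suc n) \<and> g (Suc n) \<le> Suc (g n)" if n: "n \<ge> n1" for n
  proof
    obtain z where z: "legal \<theta> z" "length z = Suc n" "count_list z x = g (Suc n)"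
      using attained[of "Suc n"] n by auto
    then obtain z' a where z': "z = z' @ [a]" by (cases z rule: rev_cases) auto
    have "z' \<noteq> []" using z(2) n z' by (auto simp: n1_def)
    then have "legal \<theta> z'" using legal_prefix z(1) z' by blast
    then show "g n \<le> g (Suc n)" using least[of z'] z z' by auto
    obtain w where w: "legal \<theta> w" "length w = n" "count_list w x = g n" using attained[OF n] by blast
    obtain e where e: "legal \<theta> (w @ e)" "length e = 1" using legal_extend_right[OF w(1)] by blast
    then show "g (Suc n) \<le> Suc (g n)" using least[OF e(1)] w by (cases e) (auto split: if_splits)
  qed
  obtain L0 where L0: "\<And>L. L \<ge> L0 \<Longrightarrow>
      \<exists>n\<ge>n1. \<exists>c\<ge>g n. c < g n + (D + 1) * (B + D) \<and> L = n * B + c * D"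
    using lattice_strip[OF B1 \<open>coprime B D\<close>, of n1 g] step by blast
  have wt: "weight (inflation_length \<theta> k) w = length w * B + count_list w x * D" for w
  proof (induction w)
    case (Cons a w)
    have "a = x \<or> a = y" using letters by auto
    then show ?case using Cons A letters(2) by (auto simp: B_def)
  qed simp
  show ?thesis
  proof (intro exI[of _ L0] allI impI)
    fix L assume "L0 \<le> L"
    then obtain n c where nc: "n \<ge> n1" "c \<ge> g n" "c < g n + (D + 1) * (B + D)" "L = n * B + c * D"
      using L0 by blast
    obtain z0 where z0: "legal \<theta> z0" "length z0 = n" "count_list z0 x = g n"
      using attained[OF nc(1)] by blast
    obtain z1 z2 where z: "legal \<theta> z1" "legal \<theta> z2" "length z1 = n" "length z2 = n"
      "count_list z1 x + (D + 1) * (B + D) \<le> count_list z2 x"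
      using n0[of n] nc(1) by (auto simp: n1_def)
    have "g n \<le> count_list z1 x" using least[OF z(1)] z(3) by simp
    then have "c < count_list z2 x" using z(5) nc(3) by linarith
    then obtain w where w: "legal \<theta> (y # w @ [x])" "Suc (length w) = n" "count_list w x = c"
      using sliding_window[OF letters z0(1) z(2) z0(2) z(4)] z0(3) nc(2) by auto
    have "weight (inflation_length \<theta> k) ([y] @ w) = L"
      unfolding wt using w letters(2) nc(4) by auto
    then show "\<exists>w. legal \<theta> ([y] @ w @ [x]) \<and> weight (inflation_length \<theta> k) ([y] @ w) = L"
      using w(1) by auto
  qed
qed

text \<open>Choose \<open>k\<close> such that \<open>u\<close> and \<open>v\<close> occur in \<open>k\<close>-fold images of every letter.  Inflating the
connecting words, which have fixed end letters, puts \<open>u\<close> into the image of the first letter and \<open>v\<close> into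
that of the last one, at fixed positions, so the gap takes all large values.\<close>

theorem Gcd_inflation_length_imp_mixing:
  assumes letters: "UNIV = {x, y}" "x \<noteq> y"
    and disc: "\<And>W. \<exists>n0. \<forall>n\<ge>n0. \<exists>z1 z2. legal \<theta> z1 \<and> legal \<theta> z2 \<and> length z1 = n \<and> length z2 = n \<and>
      count_list z1 x + W \<le> count_list z2 x"
    and gcd: "\<And>n. n \<ge> 1 \<Longrightarrow> Gcd (range (\<lambda>a. inflation_length \<theta> n a)) = 1"
  shows "topologically_mixing (RS_subshift \<theta>)"
  unfolding topologically_mixing_def language_subshift
proof (intro ballI)
  fix u v assume "u \<in> {u. legal \<theta> u}" "v \<in> {u. legal \<theta> u}"
  then have uv: "legal \<theta> u" "legal \<theta> v" by auto
  obtain k1 where k1: "\<forall>k\<ge>k1. \<forall>c. \<exists>p s. p @ u @ s \<in> iterate \<theta> k [c]"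
    using occurs_in_iterates[OF uv(1)] by blast
  obtain k2 where k2: "\<forall>k\<ge>k2. \<forall>c. \<exists>p s. p @ v @ s \<in> iterate \<theta> k [c]"
    using occurs_in_iterates[OF uv(2)] by blast
  define k where "k = max 1 (max k1 k2)"
  let ?L = "weight (inflation_length \<theta> k)"
  have "range (\<lambda>a. inflation_length \<theta> k a) = {inflation_length \<theta> k x, inflation_length \<theta> k y}"
    using letters(1) by auto
  then have cop: "coprime (inflation_length \<theta> k x) (inflation_length \<theta> k y)"
    using gcd[of k] by (simp add: k_def coprime_iff_gcd_eq_1)
  have disc_y: "\<exists>n0. \<forall>n\<ge>n0. \<exists>z1 z2. legal \<theta> z1 \<and> legal \<theta> z2 \<and> length z1 = n \<and> length z2 = n \<and>
      count_list z1 y + W \<le> count_list z2 y" for W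
  proof -
    have "length z = count_list z x + count_list z y" for z
    proof (induction z)
      case (Cons a z)
      have "a = x \<or> a = y" using letters by auto
      then show ?case using Cons letters(2) by auto
    qed simp
    then have swap: "count_list z2 y + W \<le> count_list z1 y"
      if "length z1 = length z2" "count_list z1 x + W \<le> count_list z2 x" for z1 z2
      using that by simp
    obtain n0 where n0: "\<And>n. n \<ge> n0 \<Longrightarrow> \<exists>z1 z2. legal \<theta> z1 \<and> legal \<theta> z2 \<and> length z1 = n \<and>
        length z2 = n \<and> count_list z1 x + W \<le> count_list z2 x"
      using disc[of W] by blast
    show ?thesis
    proof (intro exI[of _ n0] allI impI)
      fix n assume "n0 \<le> n"
      then obtain z1 z2 where "legal \<theta> z1" "legal \<theta> z2" "length z1 = n" "length z2 = n"
        "count_list z1 x + W \<le> count_list z2 x"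
        using n0 by blast
      then show "\<exists>z1 z2. legal \<theta> z1 \<and> legal \<theta> z2 \<and> length z1 = n \<and> length z2 = n \<and>
          count_list z1 y + W \<le> count_list z2 y"
        using swap[of z1 z2] by (intro exI[of _ z2] exI[of _ z1]) simp
    qed
  qed
  obtain a b L0 where conn: "\<And>L. L \<ge> L0 \<Longrightarrow> \<exists>w. legal \<theta> ([a] @ w @ [b]) \<and> ?L ([a] @ w) = L"
  proof (cases "inflation_length \<theta> k y \<le> inflation_length \<theta> k x")
    case True
    show ?thesis using connecting_lengths[OF letters disc True cop] that by blast
  next
    case False
    have "UNIV = {y, x}" "y \<noteq> x" using letters by auto
    then have "\<exists>L0. \<forall>L\<ge>L0. \<exists>w. legal \<theta> ([x] @ w @ [y]) \<and> ?L ([x] @ w) = L"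
      using disc_y False cop by (intro connecting_lengths) (auto simp: coprime_commute)
    then show ?thesis using that by blast
  qed
  have "k1 \<le> k" "k2 \<le> k" by (auto simp: k_def)
  then obtain p s p' s' where ps: "p @ u @ s \<in> iterate \<theta> k [a]"
    and ps': "p' @ v @ s' \<in> iterate \<theta> k [b]"
    using k1 k2 by meson
  show "\<exists>N. \<forall>n\<ge>N. \<exists>w. length w = n \<and> u @ w @ v \<in> {u. legal \<theta> u}"
  proof (intro exI[of _ "L0 + length p'"] allI impI)
    fix n assume n: "L0 + length p' \<le> n"
    obtain w where w: "legal \<theta> ([a] @ w @ [b])" "?L ([a] @ w) = n + length p + length u - length p'"
    proof -
      have "L0 \<le> n + length p + length u - length p'" using n by linarith
      then show ?thesis using conn that by blast
    qed
    obtain w' where w': "w' \<in> iterate \<theta> k w" using iterate_exists by blast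
    have "length ((p @ u @ s) @ w') = n + length p + length u - length p'"
      using length_iterate[OF iterate_appendI[OF ps w']] w(2) by simp
    then have len: "length (s @ w' @ p') = n" using n by simp
    have "(p @ u @ s) @ w' @ (p' @ v @ s') \<in> iterate \<theta> k ([a] @ w @ [b])"
      using ps ps' w' by (intro iterate_appendI)
    then have "legal \<theta> (p @ (u @ (s @ w' @ p') @ v) @ s')"
      using legal_substitute[OF w(1)] by simp
    then have "legal \<theta> (u @ (s @ w' @ p') @ v)"
      using legal_sublist legal_not_Nil[OF uv(1)] by (metis append_is_Nil_conv sublist_appendI)
    then show "\<exists>w. length w = n \<and> u @ w @ v \<in> {u. legal \<theta> u}" using len by blast
  qed
qed

section \<open>Eigenvectors of the substitution matrix\<close>

lemma off_diagonal_positive: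
  assumes letters: "UNIV = {x, y}" "x \<noteq> y"
  shows "subst_matrix \<theta> $ y $ x > 0"
proof (rule ccontr)
  assume "\<not> ?thesis"
  moreover obtain w where "w \<in> \<theta> x" using image_exists by blast
  ultimately have zero: "subst_matrix \<theta> $ y $ x = 0" using subst_matrix_nth by fastforce
  have "y \<notin> set w" if "w \<in> iterate \<theta> n [x]" for n w
    using that
  proof (induction n arbitrary: w)
    case (Suc n)
    then obtain z where z: "z \<in> iterate \<theta> n [x]" "w \<in> subst_word \<theta> z" by (auto simp: iterate_Suc)
    have "real (count_list w y) = weight (\<lambda>a. subst_matrix \<theta> $ y $ a) z"
      using weight_subst_word[of \<theta> _ "\<lambda>a. subst_matrix \<theta> $ y $ a", OF _ z(2)]
      by (simp add: real_count_list subst_matrix_nth)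
    also have "y \<notin> set z" using Suc.IH z(1) by blast
    then have "weight (\<lambda>a. subst_matrix \<theta> $ y $ a) z = weight (\<lambda>_. 0) z"
      using letters zero by (intro arg_cong[of _ _ sum_list] map_cong) auto
    finally show ?case by (simp add: count_list_0_iff)
  qed (use letters in auto)
  then show False using primitive_iterate iterate_exists by (metis UNIV_I order_refl)
qed

end

text \<open>This is the characteristic equation; eliminating one coordinate of the eigenvector gives it times the
other coordinate, and one of them is non-zero.\<close>

lemma eigenvalue_two_letters:
  fixes M :: "real ^ 'a::finite ^ 'a"
  assumes letters: "(UNIV :: 'a set) = {x, y}" "x \<noteq> y" and ev: "eigenvalue M \<mu>"
  shows "(\<mu> - M $ x $ x) * (\<mu> - M $ y $ y) = complex_of_real (M $ x $ y * M $ y $ x)"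
proof -
  obtain v where v: "v \<noteq> 0" "(\<chi> i j. complex_of_real (M $ i $ j)) *v v = \<mu> *s v"
    using ev by (auto simp: eigenvalue_def)
  have row: "M $ i $ x * v $ x + M $ i $ y * v $ y = \<mu> * v $ i" for i
    using arg_cong[OF v(2), of "\<lambda>u. u $ i"] letters(2)
    by (simp add: matrix_vector_mult_def letters(1))
  have x: "(\<mu> - M $ x $ x) * v $ x = M $ x $ y * v $ y"
    and y: "(\<mu> - M $ y $ y) * v $ y = M $ y $ x * v $ x"
    using row[of x] row[of y] by (auto simp: algebra_simps)
  have "v $ x \<noteq> 0 \<or> v $ y \<noteq> 0"
  proof (rule ccontr)
    assume "\<not> ?thesis"
    then have "v $ i = 0" for i using letters(1) by (metis UNIV_I insertE singletonD)
    then show False using v(1) by (simp add: vec_eq_iff)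
  qed
  moreover have "((\<mu> - M $ x $ x) * (\<mu> - M $ y $ y)) * v $ x = (M $ x $ y * M $ y $ x) * v $ x"
    using x y by (metis mult.assoc mult.commute of_real_mult)
  moreover have "((\<mu> - M $ x $ x) * (\<mu> - M $ y $ y)) * v $ y = (M $ x $ y * M $ y $ x) * v $ y"
    using x y by (metis mult.assoc mult.commute of_real_mult)
  ultimately show ?thesis by auto
qed

context primitive_random_substitution
begin

lemma weight_image:
  assumes letters: "UNIV = {x, y}" "x \<noteq> y" and w: "w \<in> \<theta> a"
  shows "weight f w = f x * subst_matrix \<theta> $ x $ a + f y * subst_matrix \<theta> $ y $ a"
  using letters(2) by (simp add: weight_count[of f w] letters(1) subst_matrix_nth[OF w])

text \<open>Both eigenvalues are roots of \<open>(z - p) * (z - t) = q * s\<close>, so they sum to the trace and \<open>\<mu>\<close> is real.  For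
a root \<open>c\<close> the row vector \<open>(s, c - p)\<close> is a left eigenvector, and \<open>(r - p) * (m - p) = - q * s < 0\<close> gives
the signs of the second coordinates.\<close>

lemma expanding_weights_exist:
  assumes letters: "UNIV = {x, y}" "x \<noteq> y"
    and second: "second_eigenvalue (subst_matrix \<theta>) \<mu>" and \<mu>: "cmod \<mu> > 1"
  shows "\<exists>T \<phi> r m. expanding_weights \<theta> x y T \<phi> r m"
proof -
  let ?M = "subst_matrix \<theta>"
  define p q s t where "p = ?M $ x $ x" and "q = ?M $ x $ y" and "s = ?M $ y $ x" and "t = ?M $ y $ y"
  have letters': "UNIV = {y, x}" "y \<noteq> x" using letters by auto
  have s: "s > 0" and q: "q > 0"
    using off_diagonal_positive[OF letters] off_diagonal_positive[OF letters'] by (auto simp: s_def q_def)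
  obtain r where r: "r > 0" "eigenvalue ?M (complex_of_real r)" "eigenvalue ?M \<mu>"
    "\<mu> \<noteq> complex_of_real r" and dom: "cmod \<mu> < r"
    using second by (auto simp: second_eigenvalue_def perron_frobenius_eigenvalue_def)
  have "(complex_of_real r - p) * (complex_of_real r - t) = complex_of_real (q * s)"
    using eigenvalue_two_letters[OF letters r(2)] by (simp add: p_def q_def s_def t_def)
  moreover have "(\<mu> - p) * (\<mu> - t) = complex_of_real (q * s)"
    using eigenvalue_two_letters[OF letters r(3)] by (simp add: p_def q_def s_def t_def)
  ultimately have char_r: "(complex_of_real r - p) * (complex_of_real r - t) = complex_of_real (q * s)"
    and char_\<mu>: "(\<mu> - p) * (\<mu> - t) = complex_of_real (q * s)" by auto
  have "(\<mu> - r) * (\<mu> + r - p - t) = (\<mu> - p) * (\<mu> - t) - (complex_of_real r - p) * (complex_of_real r - t)"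
    by (simp add: algebra_simps)
  then have "(\<mu> - r) * (\<mu> + r - p - t) = 0" using char_r char_\<mu> by simp
  then have "\<mu> + r - p - t = 0" using r(4) by simp
  then have "\<mu> = complex_of_real (p + t - r)" by (simp add: algebra_simps)
  moreover define m where "m = p + t - r"
  ultimately have \<mu>_m: "\<mu> = complex_of_real m" by simp
  have m: "1 < \<bar>m\<bar>" "\<bar>m\<bar> < r" using \<mu> dom by (auto simp: \<mu>_m)
  have "complex_of_real ((r - p) * (r - t)) = complex_of_real (q * s)" using char_r by simp
  then have rr: "(r - p) * (r - t) = q * s" by (simp only: of_real_eq_iff)
  have "complex_of_real ((m - p) * (m - t)) = complex_of_real (q * s)" using char_\<mu> by (simp add: \<mu>_m)
  then have mm: "(m - p) * (m - t) = q * s" by (simp only: of_real_eq_iff)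
  have "(r - p) * (m - p) = - (q * s)" using rr by (simp add: m_def algebra_simps)
  moreover have "q * s > 0" using q s by simp
  ultimately have "(r - p) * (m - p) < 0" by linarith
  then have signs: "r - p > 0" "m - p < 0" using m by (auto simp: mult_less_0_iff)
  define W where "W c a = (if a = x then s else c - p)" for c :: real and a :: 'a
  have eigen: "weight (W c) w = c * W c a"
    if "(c - p) * (c - t) = q * s" "w \<in> \<theta> a" for c w a
  proof -
    have "a = x \<or> a = y" using letters by auto
    then show ?thesis
      using weight_image[OF letters that(2), of "W c"] that(1) letters(2)
      by (auto simp: W_def p_def q_def s_def t_def algebra_simps)
  qed
  have "expanding_weights \<theta> x y (W r) (W m) r m"
    by unfold_locales (use letters signs s m eigen[OF rr] eigen[OF mm] in \<open>auto simp: W_def\<close>)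
  then show ?thesis by blast
qed

end

theorem theorem13:
  fixes \<theta> :: "'a::finite \<Rightarrow> 'a list set" and \<mu> :: complex
  assumes "CARD('a) = 2"
    and "random_substitution \<theta>"
    and "compatible \<theta>"
    and "primitive_subst \<theta>"
    and "locally_recognisable \<theta>"
    and "second_eigenvalue (subst_matrix \<theta>) \<mu>"
    and "cmod \<mu> > 1"
  shows "topologically_mixing (RS_subshift \<theta>) \<longleftrightarrow>
         (\<forall>n\<ge>1. Gcd (range (\<lambda>a. inflation_length \<theta> n a)) = 1)"
proof -
  interpret primitive_random_substitution \<theta>
    using assms by unfold_locales auto
  obtain x y :: 'a where letters: "UNIV = {x, y}" "x \<noteq> y"
    using assms(1) by (auto simp: card_2_iff)
  obtain T \<phi> r m where "expanding_weights \<theta> x y T \<phi> r m"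
    using expanding_weights_exist[OF letters assms(6,7)] by blast
  then interpret expanding_weights \<theta> x y T \<phi> r m .
  show ?thesis
  proof
    assume "topologically_mixing (RS_subshift \<theta>)"
    then show "\<forall>n\<ge>1. Gcd (range (\<lambda>a. inflation_length \<theta> n a)) = 1"
      using mixing_imp_Gcd_inflation_length[OF assms(5)] by simp
  next
    assume "\<forall>n\<ge>1. Gcd (range (\<lambda>a. inflation_length \<theta> n a)) = 1"
    then show "topologically_mixing (RS_subshift \<theta>)"
      by (intro Gcd_inflation_length_imp_mixing[OF letters unbounded_discrepancy]) simp
  qed
qed

end
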